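(* Let $\varepsilon_0\in(0,\infty)$, and let the domain $\Omega$, the kernels $\gamma=\gamma_\varepsilon$ and the decompositions $\Omega_I=\Omega_N\cup\Omega_D$, $\Gamma=\Gamma_N\cup\Gamma_D$ (for $\varepsilon\in(0,\varepsilon_0]$) be as in the context. Then there is a constant $C>0$, independent of $\varepsilon$ and of $u_l$, such that the following holds for every $\varepsilon\in(0,\varepsilon_0]$ and all data $s,g_l,v_n$ as in the context. Suppose $u_l\in C^4(\widehat\Omega)$ solves the local problem $$-\Delta u_l=s \ \text{ in }\widehat\Omega,\qquad -\nabla u_l\cdot\mathbf n=g_l\ \text{ on }\Gamma_N,\qquad u_l=v_n\ \text{ on }\Gamma_D.$$ Let $\widetilde u_{n,D}\in V(\widehat\Omega)$ be the (weak) solution of the nonlocal problem $$-\mathcal L\widetilde u_{n,D}=s\ \text{ in }\Omega,\qquad \widetilde u_{n,D}=u_l\ \text{ in }\Omega_N,\qquad \widetilde u_{n,D}=v_n\ \text{ in }\Omega_D.$$ Then $$|||\widetilde u_{n,D}-u_l|||\le C\,\varepsilon^2\,\|D^{(4)}u_l\|_{\infty,\widehat\Omega}\qquad\text{and}\qquad \|\widetilde u_{n,D}-u_l\|_{L^2(\widehat\Omega)}\le C\,\varepsilon^2\,\|D^{(4)}u_l\|_{\infty,\widehat\Omega}.$$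
   Context: Setting. $\Omega\subset\mathbb R^d$, $d\in\{1,2,3\}$, is a fixed bounded open set with Lipschitz boundary. For each horizon $\varepsilon\in(0,\varepsilon_0]$, $\Omega_I=\{y\in\mathbb R^d\setminus\Omega:\ \|y-x\|<\varepsilon \text{ for some }x\in\Omega\}$, $\widehat\Omega=\Omega\cup\Omega_I$ (this depends on $\varepsilon$), and $\Gamma=\partial\widehat\Omega$ with outer unit normal $\mathbf n$. $\Omega_I$ is the disjoint union of $\Omega_N$ and $\Omega_D$, and $\Gamma$ is the disjoint union of $\Gamma_N$ and $\Gamma_D$ ($\Gamma_N$, $\Gamma_D$ being the parts of the outer boundary adjacent to $\Omega_N$, $\Omega_D$ respectively). Kernel. $\gamma=\gamma_\varepsilon:\mathbb R^d\times\mathbb R^d\to[0,\infty)$ is symmetric, of the form $\gamma(x,y)=\alpha(x,y)\cdot\alpha(x,y)$ with $\alpha$ an antisymmetric $\mathbb R^d$-valued function, and for $x\in\Omega$ satisfies $\gamma(x,y)>0$ if $\|x-y\|<\varepsilon$ and $\gamma(x,y)=0$ for $y\in\widehat\Omega$ with $\|x-y\|\ge\varepsilon$. Operators. The nonlocal gradient is $\mathcal G w(x,y)=(w(y)-w(x))\,\alpha(x,y)$, so $|\mathcal G w(x,y)|^2=(w(y)-w(x))^2\gamma(x,y)$. The nonlocal diffusion operator is, for $x\in\Omega$, $\mathcal L w(x)=2\int_{\widehat\Omega}(w(y)-w(x))\gamma(x,y)\,dy$ (in the principal value sense if $\gamma$ is not integrable). Normalization of the kernel. $\gamma$ is scaled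 so that $\mathcal L w\to\Delta w$ as $\varepsilon\to0$, and $\mathcal L$ coincides with $\Delta$ on polynomials of degree at most three: $\mathcal L p(x)=\Delta p(x)$ for all $x\in\Omega$. Spaces. $|||v|||^2=\frac12\int_{\widehat\Omega}\int_{\widehat\Omega}|\mathcal G v(x,y)|^2\,dy\,dx$, $V(\widehat\Omega)=\{v\in L^2(\widehat\Omega): |||v|||<\infty\}$, $V_c(\widehat\Omega)=\{v\in V(\widehat\Omega): v=0 \text{ on }\Omega_D\}$, with dual $V_c'(\widehat\Omega)$ with respect to the $L^2$ pairing. $C^4(\widehat\Omega)$ denotes functions that are $C^4$ up to the boundary; these belong to $V(\widehat\Omega)$. $D^{(4)}u$ is the collection of fourth-order partial derivatives of $u$ and $\|\cdot\|_{\infty,\widehat\Omega}$ is the sup norm on $\widehat\Omega$. Data. $s\in V_c'(\widehat\Omega)$ is a forcing term over $\widehat\Omega$, $g_l\in L^2(\Gamma_N)$ is the local Neumann datum, and $v_n$ is the nonlocal Dirichlet datum on $\Omega_D$, the restriction to $\Omega_D$ of a function in $V(\widehat\Omega)$, with a well-defined trace $v_n|_{\Gamma_D}\in H^{1/2}(\Gamma_D)$. Poincaré inequality (standing assumption). There is a constant $C_{pn}$, independent of $\varepsilon\in(0,\varepsilon_0]$, with $\|v\|_{L^2(\widehat\Omega)}\le C_{pn}|||v|||$ for all $v\in V_c(\widehat\Omega)$ (in particular for all $v\in V(\widehat\Omega)$ vanishing on $\Omega_I$). Green identity (part of the nonlocal calculus framework). For $w\in C^4(\widehat\Omega)$ and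 $z\in V(\widehat\Omega)$ with $z=0$ on $\Omega_I$, $$\int_{\widehat\Omega}\int_{\widehat\Omega}(w(x)-w(y))(z(x)-z(y))\gamma(x,y)\,dy\,dx=-\int_\Omega \mathcal L w\,z\,dx.$$ Weak solution. $\widetilde u_{n,D}\in V(\widehat\Omega)$ is the weak solution of the nonlocal problem if $\widetilde u_{n,D}=u_l$ on $\Omega_N$, $\widetilde u_{n,D}=v_n$ on $\Omega_D$ and, for all $z\in V(\widehat\Omega)$ with $z=0$ on $\Omega_I$, $$\int_{\widehat\Omega}\int_{\widehat\Omega}(\widetilde u_{n,D}(x)-\widetilde u_{n,D}(y))(z(x)-z(y))\gamma(x,y)\,dy\,dx=\int_\Omega s\,z\,dx.$$ It exists and is unique.
   Formalization: The formal theorem additionally assumes v_n = u_l almost everywhere on Ω_D (not only on Γ_D); without this the claim fails, e.g. for s = g_l = u_l = 0 and v_n a nonzero bump supported inside Ω_D. *)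

theory Defs
  imports "HOL-Analysis.Analysis"
begin

section \<open>Geometry\<close>

text \<open>Locally, after a rigid motion, the set is the part of space strictly below the graph of a
  Lipschitz function of the coordinates orthogonal to \<open>\<nu>\<close>.\<close>

definition lipschitz_boundary :: "'a::euclidean_space set \<Rightarrow> bool" where
  "lipschitz_boundary \<Omega> \<longleftrightarrow>
    (\<forall>p\<in>frontier \<Omega>. \<exists>\<nu> L \<phi> r. norm \<nu> = 1 \<and> 0 < r \<and> L-lipschitz_on {v. v \<bullet> \<nu> = 0} \<phi> \<and>
      (\<forall>x\<in>ball p r. x \<in> \<Omega> \<longleftrightarrow> (x - p) \<bullet> \<nu> < \<phi> ((x - p) - ((x - p) \<bullet> \<nu>) *\<^sub>R \<nu>)))"

definition interaction_domain :: "'a::euclidean_space set \<Rightarrow> real \<Rightarrow> 'a set" where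
  "interaction_domain \<Omega> \<epsilon> = {y. y \<notin> \<Omega> \<and> (\<exists>x\<in>\<Omega>. norm (y - x) < \<epsilon>)}"

definition extended_domain :: "'a::euclidean_space set \<Rightarrow> real \<Rightarrow> 'a set" where
  "extended_domain \<Omega> \<epsilon> = \<Omega> \<union> interaction_domain \<Omega> \<epsilon>"

definition admissible_decomposition ::
    "'a::euclidean_space set \<Rightarrow> real \<Rightarrow> 'a set \<Rightarrow> 'a set \<Rightarrow> 'a set \<Rightarrow> 'a set \<Rightarrow> bool" where
  "admissible_decomposition \<Omega> \<epsilon> \<Omega>N \<Omega>D \<Gamma>N \<Gamma>D \<longleftrightarrow>
    \<Omega>N \<in> sets borel \<and> \<Omega>D \<in> sets borel \<and> \<Gamma>N \<in> sets borel \<and> \<Gamma>D \<in> sets borel \<and>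
    interaction_domain \<Omega> \<epsilon> = \<Omega>N \<union> \<Omega>D \<and> \<Omega>N \<inter> \<Omega>D = {} \<and>
    frontier (extended_domain \<Omega> \<epsilon>) = \<Gamma>N \<union> \<Gamma>D \<and> \<Gamma>N \<inter> \<Gamma>D = {} \<and>
    \<Gamma>N \<subseteq> closure \<Omega>N \<and> \<Gamma>D \<subseteq> closure \<Omega>D"

text \<open>Pointwise outer unit normal: near \<open>x\<close> the set is, to first order, the half-space
  \<open>(y - x) \<bullet> \<nu> < 0\<close>.  At a given \<open>x\<close> there is at most one such \<open>\<nu>\<close>.\<close>

definition outer_unit_normal :: "'a::euclidean_space set \<Rightarrow> 'a \<Rightarrow> 'a \<Rightarrow> bool" where
  "outer_unit_normal S x \<nu> \<longleftrightarrow> norm \<nu> = 1 \<and>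
    (\<forall>\<eta>>0. \<exists>r>0. \<forall>y\<in>ball x r.
      ((y - x) \<bullet> \<nu> < - \<eta> * norm (y - x) \<longrightarrow> y \<in> S) \<and>
      ((y - x) \<bullet> \<nu> > \<eta> * norm (y - x) \<longrightarrow> y \<notin> S))"

section \<open>Surface measure\<close>

text \<open>Surface measure is the Hausdorff measure of dimension \<open>d - 1\<close> (counting measure for
  \<open>d = 1\<close>, which is why empty members of a cover are given weight 0 explicitly).\<close>

definition hausdorff_content :: "nat \<Rightarrow> real \<Rightarrow> 'a::euclidean_space set \<Rightarrow> ennreal" where
  "hausdorff_content k \<delta> A =
    (INF U\<in>{U :: nat \<Rightarrow> 'a set. A \<subseteq> (\<Union>i. U i) \<and> (\<forall>i. bounded (U i) \<and> diameter (U i) \<le> \<delta>)}.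
      \<Sum>i. if U i = {} then 0
           else ennreal (unit_ball_vol (real k) * (diameter (U i) / 2) ^ k))"

definition hausdorff_outer :: "nat \<Rightarrow> 'a::euclidean_space set \<Rightarrow> ennreal" where
  "hausdorff_outer k A = (SUP \<delta>\<in>{0<..}. hausdorff_content k \<delta> A)"

definition surface_measure :: "'a::euclidean_space measure" where
  "surface_measure = measure_of UNIV (sets borel) (hausdorff_outer (DIM('a) - 1))"

definition square_integrable_on :: "'a measure \<Rightarrow> 'a set \<Rightarrow> ('a \<Rightarrow> real) \<Rightarrow> bool" where
  "square_integrable_on M S f \<longleftrightarrow>
    set_borel_measurable M S f \<and> set_integrable M S (\<lambda>x. (f x)\<^sup>2)"

definition L2_norm_on :: "'a::euclidean_space set \<Rightarrow> ('a \<Rightarrow> real) \<Rightarrow> real" where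
  "L2_norm_on S f = sqrt (LINT x:S|lborel. (f x)\<^sup>2)"

text \<open>\<open>H\<^sup>1\<^sup>/\<^sup>2\<close> through the Gagliardo seminorm; on a surface of dimension \<open>d - 1\<close> the exponent is
  \<open>(d - 1) + 2 \<cdot> 1/2 = d\<close>.\<close>

definition H_half_on :: "'a::euclidean_space set \<Rightarrow> ('a \<Rightarrow> real) \<Rightarrow> bool" where
  "H_half_on \<Gamma> f \<longleftrightarrow> square_integrable_on surface_measure \<Gamma> f \<and>
    (\<integral>\<^sup>+x\<in>\<Gamma>. (\<integral>\<^sup>+y\<in>\<Gamma>. ennreal ((f x - f y)\<^sup>2 / dist x y ^ DIM('a)) \<partial>surface_measure)
      \<partial>surface_measure) < \<infinity>"

text \<open>Trace as limit of local means from \<open>D\<close>, almost everywhere on \<open>\<Gamma>\<close>.  Functions in the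
  nonlocal energy space need not be weakly differentiable, so no Sobolev trace theorem is used.\<close>

definition has_trace :: "'a::euclidean_space set \<Rightarrow> 'a set \<Rightarrow> ('a \<Rightarrow> real) \<Rightarrow> ('a \<Rightarrow> real) \<Rightarrow> bool" where
  "has_trace D \<Gamma> v \<tau> \<longleftrightarrow>
    (AE x in surface_measure. x \<in> \<Gamma> \<longrightarrow>
      (\<forall>r>0. 0 < emeasure lborel (D \<inter> ball x r)) \<and>
      ((\<lambda>r. (\<integral>\<^sup>+y\<in>D \<inter> ball x r. ennreal \<bar>v y - \<tau> x\<bar> \<partial>lborel) / emeasure lborel (D \<inter> ball x r))
        \<longlongrightarrow> 0) (at_right 0))"

section \<open>Classical derivatives\<close>

definition partial_deriv :: "'a::euclidean_space \<Rightarrow> ('a \<Rightarrow> real) \<Rightarrow> 'a \<Rightarrow> real" where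
  "partial_deriv b f x = deriv (\<lambda>t. f (x + t *\<^sub>R b)) 0"

fun partial_derivs :: "'a::euclidean_space list \<Rightarrow> ('a \<Rightarrow> real) \<Rightarrow> 'a \<Rightarrow> real" where
  "partial_derivs [] f = f"
| "partial_derivs (b # bs) f = partial_deriv b (partial_derivs bs f)"

definition laplacian :: "('a::euclidean_space \<Rightarrow> real) \<Rightarrow> 'a \<Rightarrow> real" where
  "laplacian f x = (\<Sum>b\<in>Basis. partial_derivs [b, b] f x)"

text \<open>\<open>C\<^sup>k\<close> up to the boundary of the open set \<open>S\<close>: all partial derivatives of order at most \<open>k\<close>
  exist in \<open>S\<close> and extend continuously to the closure.  The values of \<open>f\<close> itself on the
  boundary are those of the extension.\<close>

definition Ck_upto_boundary :: "nat \<Rightarrow> 'a::euclidean_space set \<Rightarrow> ('a \<Rightarrow> real) \<Rightarrow> bool" where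
  "Ck_upto_boundary k S f \<longleftrightarrow>
    continuous_on (closure S) f \<and>
    (\<forall>bs. set bs \<subseteq> Basis \<and> length bs < k \<longrightarrow> partial_derivs bs f differentiable_on S) \<and>
    (\<forall>bs. set bs \<subseteq> Basis \<and> length bs \<le> k \<longrightarrow>
      (\<exists>g. continuous_on (closure S) g \<and> (\<forall>x\<in>S. g x = partial_derivs bs f x)))"

definition boundary_gradient :: "'a::euclidean_space set \<Rightarrow> ('a \<Rightarrow> real) \<Rightarrow> 'a \<Rightarrow> 'a" where
  "boundary_gradient S f x = (\<Sum>b\<in>Basis. Lim (at x within S) (partial_deriv b f) *\<^sub>R b)"

text \<open>\<open>insert 0\<close> only matters for empty \<open>S\<close>.\<close>

definition D4_sup_norm :: "'a::euclidean_space set \<Rightarrow> ('a \<Rightarrow> real) \<Rightarrow> real" where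
  "D4_sup_norm S f =
    Sup (insert 0 {\<bar>partial_derivs bs f x\<bar> | bs x. set bs \<subseteq> Basis \<and> length bs = 4 \<and> x \<in> S})"

inductive polynomial_deg_le :: "nat \<Rightarrow> ('a::euclidean_space \<Rightarrow> real) \<Rightarrow> bool" where
  const: "polynomial_deg_le n (\<lambda>x. c)"
| coord_mult: "b \<in> Basis \<Longrightarrow> polynomial_deg_le n p \<Longrightarrow> polynomial_deg_le (Suc n) (\<lambda>x. (x \<bullet> b) * p x)"
| add: "polynomial_deg_le n p \<Longrightarrow> polynomial_deg_le n q \<Longrightarrow> polynomial_deg_le n (\<lambda>x. p x + q x)"

section \<open>Nonlocal operators and spaces\<close>

definition nl_gradient :: "('a \<Rightarrow> 'a \<Rightarrow> 'a) \<Rightarrow> ('a \<Rightarrow> real) \<Rightarrow> 'a \<Rightarrow> 'a \<Rightarrow> 'a::euclidean_space" where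
  "nl_gradient \<alpha> w x y = (w y - w x) *\<^sub>R \<alpha> x y"

text \<open>Conditions on the diagonal \<open>x = y\<close> are omitted: antisymmetry there would force
  \<open>\<alpha> x x = 0\<close> and hence \<open>\<gamma> x x = 0\<close>, against positivity.  Diagonal values never matter, since
  they are multiplied by \<open>w x - w x\<close>.\<close>

definition nl_kernel ::
    "'a::euclidean_space set \<Rightarrow> real \<Rightarrow> ('a \<Rightarrow> 'a \<Rightarrow> 'a) \<Rightarrow> ('a \<Rightarrow> 'a \<Rightarrow> real) \<Rightarrow> bool" where
  "nl_kernel \<Omega> \<epsilon> \<alpha> \<gamma> \<longleftrightarrow>
    (\<lambda>p. \<alpha> (fst p) (snd p)) \<in> borel_measurable borel \<and>
    (\<forall>x y. x \<noteq> y \<longrightarrow> \<alpha> y x = - \<alpha> x y) \<and>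
    (\<forall>x y. \<gamma> x y = \<alpha> x y \<bullet> \<alpha> x y) \<and>
    (\<forall>x y. \<gamma> x y = \<gamma> y x) \<and> (\<forall>x y. 0 \<le> \<gamma> x y) \<and>
    (\<forall>x\<in>\<Omega>. \<forall>y. x \<noteq> y \<and> norm (x - y) < \<epsilon> \<longrightarrow> 0 < \<gamma> x y) \<and>
    (\<forall>x\<in>\<Omega>. \<forall>y\<in>extended_domain \<Omega> \<epsilon>. \<epsilon> \<le> norm (x - y) \<longrightarrow> \<gamma> x y = 0)"

text \<open>\<open>\<L> w x = 2 \<integral>\<^bsub>S\<^esub> (w y - w x) \<gamma> x y dy\<close> in the principal value sense; when the integrand is
  absolutely integrable the principal value is the integral.\<close>

definition has_nl_laplacian ::
    "'a::euclidean_space set \<Rightarrow> ('a \<Rightarrow> 'a \<Rightarrow> real) \<Rightarrow> ('a \<Rightarrow> real) \<Rightarrow> 'a \<Rightarrow> real \<Rightarrow> bool" where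
  "has_nl_laplacian S \<gamma> w x l \<longleftrightarrow>
    (\<forall>\<delta>>0. set_integrable lborel (S - ball x \<delta>) (\<lambda>y. (w y - w x) * \<gamma> x y)) \<and>
    ((\<lambda>\<delta>. 2 * (LINT y:(S - ball x \<delta>)|lborel. (w y - w x) * \<gamma> x y)) \<longlongrightarrow> l) (at_right 0)"

definition nl_laplacian ::
    "'a::euclidean_space set \<Rightarrow> ('a \<Rightarrow> 'a \<Rightarrow> real) \<Rightarrow> ('a \<Rightarrow> real) \<Rightarrow> 'a \<Rightarrow> real" where
  "nl_laplacian S \<gamma> w x = (THE l. has_nl_laplacian S \<gamma> w x l)"

definition nl_energy :: "'a::euclidean_space set \<Rightarrow> ('a \<Rightarrow> 'a \<Rightarrow> 'a) \<Rightarrow> ('a \<Rightarrow> real) \<Rightarrow> ennreal" where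
  "nl_energy S \<alpha> v =
    (\<integral>\<^sup>+x\<in>S. (\<integral>\<^sup>+y\<in>S. ennreal ((norm (nl_gradient \<alpha> v x y))\<^sup>2) \<partial>lborel) \<partial>lborel) / 2"

definition energy_norm :: "'a::euclidean_space set \<Rightarrow> ('a \<Rightarrow> 'a \<Rightarrow> 'a) \<Rightarrow> ('a \<Rightarrow> real) \<Rightarrow> real" where
  "energy_norm S \<alpha> v = sqrt (enn2real (nl_energy S \<alpha> v))"

definition energy_space :: "'a::euclidean_space set \<Rightarrow> ('a \<Rightarrow> 'a \<Rightarrow> 'a) \<Rightarrow> ('a \<Rightarrow> real) set" where
  "energy_space S \<alpha> = {v. square_integrable_on lborel S v \<and> nl_energy S \<alpha> v < \<infinity>}"

text \<open>Members of the energy space vanishing almost everywhere on \<open>D\<close>.\<close>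

definition energy_space_vanishing ::
    "'a::euclidean_space set \<Rightarrow> ('a \<Rightarrow> 'a \<Rightarrow> 'a) \<Rightarrow> 'a set \<Rightarrow> ('a \<Rightarrow> real) set" where
  "energy_space_vanishing S \<alpha> D =
    {v \<in> energy_space S \<alpha>. AE x in lborel. x \<in> D \<longrightarrow> v x = 0}"

text \<open>\<open>s\<close> represents, through the \<open>L\<^sup>2\<close> pairing, a bounded functional on the constrained space.\<close>

definition in_constrained_dual ::
    "'a::euclidean_space set \<Rightarrow> ('a \<Rightarrow> 'a \<Rightarrow> 'a) \<Rightarrow> 'a set \<Rightarrow> ('a \<Rightarrow> real) \<Rightarrow> bool" where
  "in_constrained_dual S \<alpha> D s \<longleftrightarrow>
    set_borel_measurable lborel S s \<and>
    (\<forall>z\<in>energy_space_vanishing S \<alpha> D. set_integrable lborel S (\<lambda>x. s x * z x)) \<and>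
    (\<exists>K. \<forall>z\<in>energy_space_vanishing S \<alpha> D.
      \<bar>LINT x:S|lborel. s x * z x\<bar> \<le> K * energy_norm S \<alpha> z)"

definition nl_form ::
    "'a::euclidean_space set \<Rightarrow> ('a \<Rightarrow> 'a \<Rightarrow> real) \<Rightarrow> ('a \<Rightarrow> real) \<Rightarrow> ('a \<Rightarrow> real) \<Rightarrow> real" where
  "nl_form S \<gamma> w z =
    (LINT x:S|lborel. (LINT y:S|lborel. (w x - w y) * (z x - z y) * \<gamma> x y))"

definition green_identity ::
    "'a::euclidean_space set \<Rightarrow> real \<Rightarrow> ('a \<Rightarrow> 'a \<Rightarrow> 'a) \<Rightarrow> ('a \<Rightarrow> 'a \<Rightarrow> real) \<Rightarrow> bool" where
  "green_identity \<Omega> \<epsilon> \<alpha> \<gamma> \<longleftrightarrow>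
    (\<forall>w z. Ck_upto_boundary 4 (extended_domain \<Omega> \<epsilon>) w \<longrightarrow>
      z \<in> energy_space_vanishing (extended_domain \<Omega> \<epsilon>) \<alpha> (interaction_domain \<Omega> \<epsilon>) \<longrightarrow>
      nl_form (extended_domain \<Omega> \<epsilon>) \<gamma> w z =
        - (LINT x:\<Omega>|lborel. nl_laplacian (extended_domain \<Omega> \<epsilon>) \<gamma> w x * z x))"

section \<open>Data and solutions\<close>

definition dirichlet_datum ::
    "'a::euclidean_space set \<Rightarrow> ('a \<Rightarrow> 'a \<Rightarrow> 'a) \<Rightarrow> 'a set \<Rightarrow> 'a set \<Rightarrow> ('a \<Rightarrow> real) \<Rightarrow> ('a \<Rightarrow> real) \<Rightarrow> bool"
  where
  "dirichlet_datum S \<alpha> \<Omega>D \<Gamma>D vn \<tau> \<longleftrightarrow>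
    set_borel_measurable lborel \<Omega>D vn \<and>
    (\<exists>v\<in>energy_space S \<alpha>. AE x in lborel. x \<in> \<Omega>D \<longrightarrow> vn x = v x) \<and>
    has_trace \<Omega>D \<Gamma>D vn \<tau> \<and> H_half_on \<Gamma>D \<tau>"

text \<open>Classical solution of the mixed local problem in \<open>S\<close>, with Neumann datum \<open>gl\<close> on \<open>\<Gamma>N\<close> and
  Dirichlet boundary datum \<open>\<tau>\<close> on \<open>\<Gamma>D\<close>.\<close>

definition local_solution ::
    "'a::euclidean_space set \<Rightarrow> 'a set \<Rightarrow> 'a set \<Rightarrow> ('a \<Rightarrow> real) \<Rightarrow> ('a \<Rightarrow> real) \<Rightarrow> ('a \<Rightarrow> real) \<Rightarrow>
      ('a \<Rightarrow> real) \<Rightarrow> bool" where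
  "local_solution S \<Gamma>N \<Gamma>D s gl \<tau> ul \<longleftrightarrow>
    Ck_upto_boundary 4 S ul \<and>
    (AE x in lborel. x \<in> S \<longrightarrow> - laplacian ul x = s x) \<and>
    (AE x in surface_measure. x \<in> \<Gamma>N \<longrightarrow>
      (\<forall>\<nu>. outer_unit_normal S x \<nu> \<longrightarrow> - (boundary_gradient S ul x \<bullet> \<nu>) = gl x)) \<and>
    (AE x in surface_measure. x \<in> \<Gamma>D \<longrightarrow> ul x = \<tau> x)"

text \<open>The boundary condition \<open>ul = \<tau>\<close> on \<open>\<Gamma>D\<close> does not control \<open>vn - ul\<close> in the interior of \<open>\<Omega>D\<close>,
  where a weak solution equals \<open>vn\<close>.  An error bound by \<open>D4_sup_norm ul\<close> therefore needs
  \<open>vn = ul\<close> almost everywhere on \<open>\<Omega>D\<close> as a separate hypothesis: for \<open>s = 0\<close>, \<open>ul = 0\<close> and \<open>vn\<close> a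
  bump supported in the interior of \<open>\<Omega>D\<close>, the bound is 0 but the error is not.\<close>

definition nl_weak_solution ::
    "'a::euclidean_space set \<Rightarrow> real \<Rightarrow> ('a \<Rightarrow> 'a \<Rightarrow> 'a) \<Rightarrow> ('a \<Rightarrow> 'a \<Rightarrow> real) \<Rightarrow> 'a set \<Rightarrow> 'a set \<Rightarrow>
      ('a \<Rightarrow> real) \<Rightarrow> ('a \<Rightarrow> real) \<Rightarrow> ('a \<Rightarrow> real) \<Rightarrow> ('a \<Rightarrow> real) \<Rightarrow> bool" where
  "nl_weak_solution \<Omega> \<epsilon> \<alpha> \<gamma> \<Omega>N \<Omega>D s ul vn u \<longleftrightarrow>
    u \<in> energy_space (extended_domain \<Omega> \<epsilon>) \<alpha> \<and>
    (AE x in lborel. x \<in> \<Omega>N \<longrightarrow> u x = ul x) \<and>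
    (AE x in lborel. x \<in> \<Omega>D \<longrightarrow> u x = vn x) \<and>
    (\<forall>z\<in>energy_space_vanishing (extended_domain \<Omega> \<epsilon>) \<alpha> (interaction_domain \<Omega> \<epsilon>).
      nl_form (extended_domain \<Omega> \<epsilon>) \<gamma> u z = (LINT x:\<Omega>|lborel. s x * z x))"

end

(* Since \<L> agrees with \<Delta> on cubics, \<L> u_l - \<Delta> u_l at x is \<L> applied to the third-order
   Taylor remainder at x, which on the ball of radius \<epsilon> is at most a multiple of
   \<epsilon>^2 |D4 u_l| |y - x|^2; and \<L> |y - x|^2 = 2d, again by exactness.  Thus the consistency
   error is O(\<epsilon>^2) uniformly in the kernel.  The error e = u - u_l vanishes on \<Omega>_I, so it is an
   admissible test function; the weak formulation and the Green identity give
   2 |||e|||^2 = \<integral>_\<Omega> (\<L> u_l - \<Delta> u_l) e, and the Poincare inequality closes the estimate. *)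
theory Submission
  imports Defs
begin

section \<open>Taylor expansion\<close>

text \<open>The obstacle is that \<L> is a principal value: for a singular kernel neither its
  existence at u_l nor a majorant for the truncated integrals is given. Cubic exactness supplies
  both. On the Taylor polynomial it accounts for the part whose integral may converge only through
  cancellation. On |y - x|^2 the integrand is nonnegative, so the truncated integrals increase as
  the ball shrinks, and their limit makes the second moment of the kernel an ordinary Lebesgue
  integral with value d. That moment dominates the remainder. The consistency constant is 2 * d *
  d^4/24 = d^5/12: 2 from the definition of \<L>, d from the second moment, d^4/4! from the Taylor
  remainder summed over ordered index lists. Splitting the integral of (s + \<L> u_l) e further
  requires (\<L> u_l) e to be integrable. Measurability comes from writing \<L> u_l as a limit of
  truncated integrals, the majorant from the pairing of s with e and the boundedness of s + \<L>
  u_l.\<close>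

text \<open>\<open>(h \<bullet> \<nabla>)\<^sup>k\<close> expanded over ordered index lists, so that symmetry of mixed partial derivatives
  is never needed.\<close>

fun dir_derivs :: "nat \<Rightarrow> 'a::euclidean_space list \<Rightarrow> ('a \<Rightarrow> real) \<Rightarrow> 'a \<Rightarrow> 'a \<Rightarrow> real" where
  "dir_derivs 0 bs f h z = partial_derivs bs f z"
| "dir_derivs (Suc k) bs f h z = (\<Sum>b\<in>Basis. (h \<bullet> b) * dir_derivs k (b # bs) f h z)"

text \<open>The sum over ordered index lists already carries the multinomial multiplicities, so
  \<open>1 / fact m\<close> is the only weight. The base point precedes the variable, so that
  \<open>taylor3 f x\<close> is the Taylor polynomial as a function.\<close>

definition taylor3 :: "('a::euclidean_space \<Rightarrow> real) \<Rightarrow> 'a \<Rightarrow> 'a \<Rightarrow> real" where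
  "taylor3 f x y = (\<Sum>m<4. dir_derivs m [] f (y - x) x / fact m)"

text \<open>\<open>partial_deriv\<close> rests on \<open>deriv\<close>, a choice operator, so its
  value can be computed only from an actual derivative; the chain rule along the line in direction
  \<open>b\<close> supplies one.\<close>

lemma partial_deriv_has_derivative:
  assumes "(f has_derivative f') (at z)"
  shows "partial_deriv b f z = f' b"
proof -
  have "((\<lambda>t. f (z + t *\<^sub>R b)) has_derivative (\<lambda>t. f' (t *\<^sub>R b))) (at 0)"
    by (rule has_derivative_compose[of "\<lambda>t. z + t *\<^sub>R b" _ 0 UNIV f f'])
       (auto intro!: derivative_eq_intros simp: assms)
  then have "((\<lambda>t. f (z + t *\<^sub>R b)) has_field_derivative f' b) (at 0)"
    using linear_scale[OF has_derivative_linear[OF assms]]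
    by (simp add: has_field_derivative_def mult.commute[of _ "f' b"] fun_eq_iff)
  then show ?thesis unfolding partial_deriv_def by (rule DERIV_imp_deriv)
qed

text \<open>Chain rule along the line: differentiating in \<open>t\<close> applies one more factor
  \<open>h \<bullet> \<nabla>\<close>. The recursion conses new indices onto \<open>bs\<close>,
  hence the induction over all \<open>bs\<close>; \<open>k + length bs\<close> is the order of the
  derivatives at the leaves, which must be differentiable once more.\<close>

lemma dir_derivs_has_field_derivative:
  assumes "\<And>bs. set bs \<subseteq> Basis \<Longrightarrow> length bs < n \<Longrightarrow> partial_derivs bs f differentiable (at (x + t *\<^sub>R h))"
    and "set bs \<subseteq> Basis" "k + length bs < n"
  shows "((\<lambda>t. dir_derivs k bs f h (x + t *\<^sub>R h)) has_field_derivative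
           dir_derivs (Suc k) bs f h (x + t *\<^sub>R h)) (at t)"
  using assms(2,3)
proof (induction k arbitrary: bs)
  case 0
  then obtain f' where f': "(partial_derivs bs f has_derivative f') (at (x + t *\<^sub>R h))"
    using assms(1)[of bs] unfolding differentiable_def by auto
  have lin: "linear f'" using f' by (rule has_derivative_linear)
  have "((\<lambda>t. partial_derivs bs f (x + t *\<^sub>R h)) has_derivative (\<lambda>s. f' (s *\<^sub>R h))) (at t)"
    by (rule has_derivative_compose[of "\<lambda>t. x + t *\<^sub>R h" _ t UNIV _ f'])
       (auto intro!: derivative_eq_intros simp: f')
  then have "((\<lambda>t. partial_derivs bs f (x + t *\<^sub>R h)) has_field_derivative f' h) (at t)"
    using linear_scale[OF lin]
    by (simp add: has_field_derivative_def mult.commute[of _ "f' h"] fun_eq_iff)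
  moreover have "f' h = (\<Sum>b\<in>Basis. (h \<bullet> b) * f' b)"
    by (subst euclidean_representation[of h, symmetric])
       (simp add: linear_sum[OF lin] linear_scale[OF lin] del: euclidean_representation)
  moreover have "\<And>b. partial_deriv b (partial_derivs bs f) (x + t *\<^sub>R h) = f' b"
    using f' by (rule partial_deriv_has_derivative)
  ultimately show ?case by simp
next
  case (Suc k)
  have "((\<lambda>t. \<Sum>b\<in>Basis. (h \<bullet> b) * dir_derivs k (b # bs) f h (x + t *\<^sub>R h)) has_field_derivative
      (\<Sum>b\<in>Basis. (h \<bullet> b) * dir_derivs (Suc k) (b # bs) f h (x + t *\<^sub>R h))) (at t)"
    by (rule DERIV_sum, rule DERIV_cmult, rule Suc.IH) (use Suc.prems in auto)
  then show ?case by simp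
qed

text \<open>Unfolding produces one term for each choice of \<open>k\<close> indices, each with
  \<open>k\<close> coordinates of \<open>h\<close> bounded by its norm.\<close>

lemma abs_dir_derivs_le:
  assumes "\<And>bs. set bs \<subseteq> Basis \<Longrightarrow> length bs = n \<Longrightarrow> \<bar>partial_derivs bs f z\<bar> \<le> M"
    and "set bs \<subseteq> Basis" "k + length bs = n"
  shows "\<bar>dir_derivs k bs f h z\<bar> \<le> (real DIM('a::euclidean_space) * norm (h::'a)) ^ k * M"
  using assms(2,3)
proof (induction k arbitrary: bs)
  case 0
  then show ?case using assms(1)[of bs] by simp
next
  case (Suc k)
  let ?B = "(real DIM('a) * norm h) ^ k * M"
  have "\<bar>dir_derivs (Suc k) bs f h z\<bar> \<le> (\<Sum>b\<in>Basis. \<bar>(h \<bullet> b) * dir_derivs k (b # bs) f h z\<bar>)"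
    unfolding dir_derivs.simps by (rule sum_abs)
  also have "\<dots> \<le> (\<Sum>b\<in>(Basis::'a set). norm h * ?B)"
  proof (rule sum_mono)
    fix b :: 'a assume b: "b \<in> Basis"
    have "\<bar>dir_derivs k (b # bs) f h z\<bar> \<le> ?B"
      by (rule Suc.IH) (use Suc.prems b in auto)
    then show "\<bar>(h \<bullet> b) * dir_derivs k (b # bs) f h z\<bar> \<le> norm h * ?B"
      unfolding abs_mult using Basis_le_norm[OF b, of h] by (intro mult_mono) auto
  qed
  also have "\<dots> = (real DIM('a) * norm h) ^ Suc k * M" by simp
  finally show ?case .
qed

text \<open>Every index choice other than the constant one has a vanishing coordinate factor. This
  makes the Taylor polynomial explicit on coordinate lines, which is all that its Laplacian
  sees.\<close>

lemma dir_derivs_axis: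
  assumes "b \<in> Basis"
  shows "dir_derivs k bs f (t *\<^sub>R b) z = t ^ k * partial_derivs (replicate k b @ bs) f z"
proof (induction k arbitrary: bs)
  case (Suc k)
  have "dir_derivs (Suc k) bs f (t *\<^sub>R b) z = 
      (\<Sum>c\<in>Basis. if c = b then t * dir_derivs k (b # bs) f (t *\<^sub>R b) z else 0)"
    unfolding dir_derivs.simps by (rule sum.cong) (auto simp: inner_Basis assms)
  then show ?case using assms Suc[of "b # bs"] by (simp add: replicate_app_Cons_same)
qed simp

text \<open>Lagrange's remainder for the restriction of \<open>f\<close> to the segment, whose
  successive derivatives are the \<open>dir_derivs\<close>. Regularity is asked on the segment only,
  because the domain need not be convex.\<close>

lemma taylor3_remainder:
  fixes x y :: "'a::euclidean_space"
  assumes diff: "\<And>bs z. set bs \<subseteq> Basis \<Longrightarrow> length bs < 4 \<Longrightarrow> z \<in> closed_segment x y \<Longrightarrow>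
      partial_derivs bs f differentiable (at z)"
    and bound: "\<And>bs z. set bs \<subseteq> Basis \<Longrightarrow> length bs = 4 \<Longrightarrow> z \<in> closed_segment x y \<Longrightarrow>
      \<bar>partial_derivs bs f z\<bar> \<le> M"
  shows "\<bar>f y - taylor3 f x y\<bar> \<le> real DIM('a) ^ 4 / 24 * M * norm (y - x) ^ 4"
proof -
  define h where "h = y - x"
  have seg: "x + t *\<^sub>R h \<in> closed_segment x y" if "0 \<le> t" "t \<le> 1" for t
    using that unfolding h_def closed_segment_def by (auto intro!: exI[of _ t] simp: algebra_simps)
  have "\<exists>t::real. 0 < t \<and> t < 1 \<and>
     f (x + 1 *\<^sub>R h) = (\<Sum>m<4. dir_derivs m [] f h (x + 0 *\<^sub>R h) / fact m * 1 ^ m)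
       + dir_derivs 4 [] f h (x + t *\<^sub>R h) / fact 4 * 1 ^ 4"
  proof (rule Maclaurin[of _ _ "\<lambda>m t. dir_derivs m [] f h (x + t *\<^sub>R h)" "\<lambda>t. f (x + t *\<^sub>R h)"])
    show "\<forall>m t. m < 4 \<and> 0 \<le> t \<and> t \<le> 1 \<longrightarrow> ((\<lambda>t. dir_derivs m [] f h (x + t *\<^sub>R h))
        has_real_derivative dir_derivs (Suc m) [] f h (x + t *\<^sub>R h)) (at t)"
      using diff seg by (intro allI impI dir_derivs_has_field_derivative[where n = 4]) auto
  qed auto
  then obtain t where t: "0 < t" "t < 1" 
    and eq: "f y = taylor3 f x y + dir_derivs 4 [] f h (x + t *\<^sub>R h) / fact 4"
    by (auto simp: h_def taylor3_def)
  have "\<bar>dir_derivs 4 [] f h (x + t *\<^sub>R h)\<bar> \<le> (real DIM('a) * norm h) ^ 4 * M"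
    by (rule abs_dir_derivs_le[where n = 4]) (use bound seg t in auto)
  then show ?thesis unfolding eq h_def by (simp add: power_mult_distrib fact_numeral mult_ac)
qed

section \<open>Closure properties of polynomials of bounded degree\<close>

lemma polynomial_deg_le_cmult:
  "polynomial_deg_le n p \<Longrightarrow> polynomial_deg_le n (\<lambda>x. c * p x)"
proof (induction rule: polynomial_deg_le.induct)
  case (const n d)
  show ?case by (rule polynomial_deg_le.const)
next
  case (coord_mult b n p)
  then have "polynomial_deg_le (Suc n) (\<lambda>x. (x \<bullet> b) * (c * p x))"
    by (intro polynomial_deg_le.coord_mult)
  then show ?case by (simp add: mult_ac)
next
  case (add n p q)
  then have "polynomial_deg_le n (\<lambda>x. c * p x + c * q x)"
    by (intro polynomial_deg_le.add)
  then show ?case by (simp add: algebra_simps)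
qed

lemma polynomial_deg_le_Suc:
  "polynomial_deg_le n p \<Longrightarrow> polynomial_deg_le (Suc n) p"
  by (induction rule: polynomial_deg_le.induct) (auto intro: polynomial_deg_le.intros)

lemma polynomial_deg_le_mono:
  assumes "polynomial_deg_le m p" "m \<le> n"
  shows "polynomial_deg_le n p"
  using assms(2,1) by (induction rule: dec_induct) (auto intro: polynomial_deg_le_Suc)

text \<open>The introduction rules know only coordinates about the origin; recentring at
  \<open>x\<close> adds a constant multiple of \<open>p\<close>, of lower degree.\<close>

lemma polynomial_deg_le_shifted_coord_mult:
  assumes "b \<in> Basis" "polynomial_deg_le n p"
  shows "polynomial_deg_le (Suc n) (\<lambda>y. ((y - x) \<bullet> b) * p y)"
proof -
  have "polynomial_deg_le (Suc n) (\<lambda>y. (y \<bullet> b) * p y + (- (x \<bullet> b)) * p y)"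
    by (intro polynomial_deg_le.add polynomial_deg_le.coord_mult polynomial_deg_le_cmult
        polynomial_deg_le_Suc assms)
  then show ?thesis by (simp add: algebra_simps)
qed

lemma polynomial_deg_le_sum:
  assumes "finite A" "\<And>i. i \<in> A \<Longrightarrow> polynomial_deg_le n (p i)"
  shows "polynomial_deg_le n (\<lambda>x. \<Sum>i\<in>A. p i x)"
  using assms by (induction A) (auto intro: polynomial_deg_le.intros)

text \<open>The derivatives are frozen at \<open>x\<close>; only the \<open>k\<close> coordinate
  factors of \<open>y - x\<close> vary with \<open>y\<close>.\<close>

lemma polynomial_deg_le_dir_derivs: "polynomial_deg_le k (\<lambda>y. dir_derivs k bs f (y - x) x)"
  by (induction k arbitrary: bs)
     (auto intro!: polynomial_deg_le.const polynomial_deg_le_sum polynomial_deg_le_shifted_coord_mult)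

lemma polynomial_deg_le_taylor3: "polynomial_deg_le 3 (taylor3 f x)"
proof -
  have "polynomial_deg_le 3 (\<lambda>y. \<Sum>m<4. (1 / fact m) * dir_derivs m [] f (y - x) x)"
    by (intro polynomial_deg_le_sum polynomial_deg_le_cmult
        polynomial_deg_le_mono[OF polynomial_deg_le_dir_derivs]) auto
  then show ?thesis unfolding taylor3_def[abs_def] by simp
qed

text \<open>The second test polynomial: exactness on it determines the second moment of the
  kernel.\<close>

lemma polynomial_deg_le_dist_power2: "polynomial_deg_le 2 (\<lambda>y. (norm (y - x))\<^sup>2)"
proof -
  have "polynomial_deg_le (Suc (Suc 0)) (\<lambda>y. \<Sum>b\<in>Basis. ((y - x) \<bullet> b) * (((y - x) \<bullet> b) * 1))"
    by (intro polynomial_deg_le_sum polynomial_deg_le_shifted_coord_mult polynomial_deg_le.const)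
       auto
  moreover have "(norm (y - x))\<^sup>2 = (\<Sum>b\<in>Basis. ((y - x) \<bullet> b) * (((y - x) \<bullet> b) * 1))" for y
    by (simp only: power2_norm_eq_inner euclidean_inner[of "y - x" "y - x"] mult_1_right)
  ultimately show ?thesis by (simp only: numeral_2_eq_2)
qed

text \<open>A pure second derivative depends only on the restriction to one line, so its value is
  read off there. The formula is required for all \<open>t\<close>, because the outer derivative
  sees the inner one at neighbouring points.\<close>

lemma partial_derivs_twice_cubic:
  assumes "\<And>t. p (x + t *\<^sub>R b) = c0 + t * c1 + t\<^sup>2 * c2 / 2 + t ^ 3 * c3"
  shows "partial_derivs [b, b] p x = c2"
proof -
  have "partial_deriv b p (x + t *\<^sub>R b) = c1 + t * c2 + 3 * t\<^sup>2 * c3" for t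
  proof -
    have "(\<lambda>s. p (x + t *\<^sub>R b + s *\<^sub>R b)) =
        (\<lambda>s. c0 + (t + s) * c1 + (t + s)\<^sup>2 * c2 / 2 + (t + s) ^ 3 * c3)"
      using assms[of "t + _"] by (auto simp: scaleR_add_left add.assoc)
    then show ?thesis unfolding partial_deriv_def
      by (auto intro!: DERIV_imp_deriv derivative_eq_intros simp: power2_eq_square)
  qed
  then have "partial_deriv b (partial_deriv b p) x = deriv (\<lambda>t. c1 + t * c2 + 3 * t\<^sup>2 * c3) 0"
    by (subst partial_deriv_def) simp
  also have "\<dots> = c2" by (auto intro!: DERIV_imp_deriv derivative_eq_intros)
  finally show ?thesis by (simp only: partial_derivs.simps)
qed

text \<open>On each coordinate line through \<open>x\<close> the Taylor polynomial is an explicit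
  cubic in \<open>t\<close>, whose quadratic coefficient is half the pure second derivative of
  \<open>f\<close> at \<open>x\<close>.\<close>

lemma laplacian_taylor3: "laplacian (taylor3 f x) x = laplacian f x"
  unfolding laplacian_def
proof (rule sum.cong[OF refl])
  fix b :: 'a assume b: "b \<in> Basis"
  show "partial_derivs [b, b] (taylor3 f x) x = partial_derivs [b, b] f x"
  proof (rule partial_derivs_twice_cubic)
    fix t
    show "taylor3 f x (x + t *\<^sub>R b) = f x + t * partial_derivs [b] f x + t\<^sup>2 * partial_derivs [b, b] f x / 2
        + t ^ 3 * (partial_derivs [b, b, b] f x / 6)"
      by (simp add: taylor3_def dir_derivs_axis[OF b] lessThan_nat_numeral lessThan_Suc fact_numeral numeral_eq_Suc
        del: dir_derivs.simps)
  qed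
qed

lemma laplacian_dist_power2:
  "laplacian (\<lambda>y. (norm (y - x))\<^sup>2) x = 2 * real DIM('a)" for x :: "'a::euclidean_space"
proof -
  have "partial_derivs [b, b] (\<lambda>y. (norm (y - x))\<^sup>2) x = 2" if "b \<in> Basis" for b :: 'a
    by (rule partial_derivs_twice_cubic[where ?c0.0 = 0 and ?c1.0 = 0 and ?c3.0 = 0])
       (use that in \<open>simp add: power_mult_distrib\<close>)
  then show ?thesis by (simp add: laplacian_def)
qed

text \<open>The nonlocal operator subtracts the value at \<open>x\<close>; this equality lets the
  subtracted terms of \<open>f\<close> and of its Taylor polynomial cancel.\<close>

lemma taylor3_self: "taylor3 f x x = f x"
proof -
  have "dir_derivs (Suc k) bs f 0 x = 0" for k bs by simp
  then show ?thesis by (simp add: taylor3_def numeral_eq_Suc)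
qed

section \<open>Principal values and consistency\<close>

text \<open>A point other than \<open>x\<close> eventually leaves the shrinking balls, while
  \<open>x\<close> lies in all of them; hence the limit set is \<open>S - {x}\<close> and not
  \<open>S\<close>.\<close>

lemma eventually_indicator_remove_ball:
  "\<forall>\<^sub>F \<delta> in at_right 0. indicator (S - ball x \<delta>) y = (indicator (S - {x}) y :: real)"
  for x y :: "'a::metric_space"
proof (cases "y = x")
  case True
  then show ?thesis by (intro eventually_mono[OF eventually_at_right_less[of 0]]) auto
next
  case False
  then have "\<forall>\<^sub>F \<delta> in at_right 0. \<delta> < dist x y"
    by (intro order_tendstoD(2)[OF tendsto_ident_at]) auto
  then show ?thesis by (rule eventually_mono) (use False in \<open>auto simp: indicator_def\<close>)
qed

text \<open>With an integrable majorant a principal value is an ordinary integral, by dominated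
  convergence. In the consistency proof the majorant is a multiple of the second-moment
  density.\<close>

lemma truncation_limit_dominated:
  fixes r g :: "'a::euclidean_space \<Rightarrow> real"
  assumes S: "S \<in> sets borel" and g: "set_integrable lborel (S - {x}) g"
    and r: "set_borel_measurable lborel S r" and le: "\<And>y. y \<in> S - {x} \<Longrightarrow> \<bar>r y\<bar> \<le> g y"
  shows "((\<lambda>\<delta>. LINT y:(S - ball x \<delta>)|lborel. r y) \<longlongrightarrow> (LINT y:(S - {x})|lborel. r y)) (at_right 0)"
    and "A \<in> sets borel \<Longrightarrow> A \<subseteq> S - {x} \<Longrightarrow> set_integrable lborel A r"
proof -
  have m: "(\<lambda>y. indicator A y *\<^sub>R r y) \<in> borel_measurable lborel" if "A \<in> sets borel" "A \<subseteq> S" for A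
    using set_borel_measurable_subset[OF r, of A] that by (simp add: set_borel_measurable_def)
  show "((\<lambda>\<delta>. LINT y:(S - ball x \<delta>)|lborel. r y) \<longlongrightarrow> (LINT y:(S - {x})|lborel. r y)) (at_right 0)"
    unfolding set_lebesgue_integral_def
  \<comment> \<open>The limit is tested on sequences of radii tending to 0; the endpoint 1 is an
    arbitrary bound on them.\<close>
  proof (rule tendsto_at_right_sequentially[of 0 1])
    fix \<delta> :: "nat \<Rightarrow> real"
    assume \<delta>: "\<And>n. 0 < \<delta> n" "\<delta> \<longlonglongrightarrow> 0"
    have "\<delta> n \<noteq> 0" for n using \<delta>(1)[of n] by simp
    then have lim: "filterlim \<delta> (at_right 0) sequentially"
      using \<delta> by (auto simp: filterlim_at)
    show "(\<lambda>n. LINT y|lborel. indicator (S - ball x (\<delta> n)) y *\<^sub>R r y)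
        \<longlonglongrightarrow> (LINT y|lborel. indicator (S - {x}) y *\<^sub>R r y)"
    proof (rule integral_dominated_convergence[where w = "\<lambda>y. indicator (S - {x}) y *\<^sub>R g y"])
      show "integrable lborel (\<lambda>y. indicator (S - {x}) y *\<^sub>R g y)"
        using g by (simp add: set_integrable_def)
      show "AE y in lborel. (\<lambda>n. indicator (S - ball x (\<delta> n)) y *\<^sub>R r y)
          \<longlonglongrightarrow> indicator (S - {x}) y *\<^sub>R r y"
      proof (rule AE_I2)
        fix y
        have "\<forall>\<^sub>F n in sequentially. indicator (S - ball x (\<delta> n)) y = (indicator (S - {x}) y :: real)"
          using eventually_indicator_remove_ball lim by (rule eventually_compose_filterlim)
        then show "(\<lambda>n. indicator (S - ball x (\<delta> n)) y *\<^sub>R r y)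
          \<longlonglongrightarrow> indicator (S - {x}) y *\<^sub>R r y"
          by (intro tendsto_eventually) (auto elim: eventually_mono)
      qed
      show "AE y in lborel. norm (indicator (S - ball x (\<delta> n)) y *\<^sub>R r y)
          \<le> indicator (S - {x}) y *\<^sub>R g y" for n
      proof (rule AE_I2)
        fix y
        show "norm (indicator (S - ball x (\<delta> n)) y *\<^sub>R r y) \<le> indicator (S - {x}) y *\<^sub>R g y"
          using le[of y] \<delta>(1)[of n] by (auto simp: indicator_def)
      qed
    qed (use m S in auto)
  qed simp
  show "set_integrable lborel A r" if A: "A \<in> sets borel" "A \<subseteq> S - {x}"
    unfolding set_integrable_def
  proof (rule Bochner_Integration.integrable_bound)
    show "integrable lborel (\<lambda>y. indicator (S - {x}) y *\<^sub>R g y)"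
      using g by (simp add: set_integrable_def)
    show "(\<lambda>y. indicator A y *\<^sub>R r y) \<in> borel_measurable lborel" using m A by auto
    show "AE y in lborel. norm (indicator A y *\<^sub>R r y) \<le> norm (indicator (S - {x}) y *\<^sub>R g y)"
    proof (rule AE_I2)
      fix y
      show "norm (indicator A y *\<^sub>R r y) \<le> norm (indicator (S - {x}) y *\<^sub>R g y)"
        using le[of y] A by (auto simp: indicator_def)
    qed
  qed
qed

text \<open>A converse for nonnegative integrands: truncated integrals can converge only if the
  whole integral is finite, by monotone convergence along decreasing radii. No majorant is assumed;
  the result is what later serves as one.\<close>

lemma truncation_limit_nonneg:
  fixes g :: "'a::euclidean_space \<Rightarrow> real"
  assumes S: "S \<in> sets borel" and g0: "\<And>y. 0 \<le> g y"
    and int: "\<And>\<delta>. 0 < \<delta> \<Longrightarrow> set_integrable lborel (S - ball x \<delta>) g"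
    and lim: "((\<lambda>\<delta>. LINT y:(S - ball x \<delta>)|lborel. g y) \<longlongrightarrow> l) (at_right 0)"
  shows "set_integrable lborel (S - {x}) g" and "(LINT y:(S - {x})|lborel. g y) = l"
proof -
  define \<delta> :: "nat \<Rightarrow> real" where "\<delta> = (\<lambda>n. inverse (real (Suc n)))"
  have flim: "filterlim \<delta> (at_right 0) sequentially"
    unfolding filterlim_at \<delta>_def using LIMSEQ_inverse_real_of_nat by auto
  have dec: "\<delta> n \<le> \<delta> m" if "m \<le> n" for m n
    using that by (simp add: \<delta>_def)
  have pos: "\<delta> n > 0" for n by (simp add: \<delta>_def)
  let ?f = "\<lambda>n y. indicator (S - ball x (\<delta> n)) y *\<^sub>R g y"
  let ?u = "\<lambda>y. indicator (S - {x}) y *\<^sub>R g y"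
  have conv: "(\<lambda>n. ?f n y) \<longlonglongrightarrow> ?u y" for y
  proof -
    have "\<forall>\<^sub>F n in sequentially. indicator (S - ball x (\<delta> n)) y = (indicator (S - {x}) y :: real)"
      using eventually_indicator_remove_ball flim by (rule eventually_compose_filterlim)
    then show ?thesis by (intro tendsto_eventually) (auto elim: eventually_mono)
  qed
  have fi: "integrable lborel (?f n)" for n
    using int[OF pos[of n]] by (simp add: set_integrable_def)
  have um: "?u \<in> borel_measurable lborel"
    by (rule borel_measurable_LIMSEQ_real[of _ ?f]) (use conv fi in auto)
  have fl: "(\<lambda>n. integral\<^sup>L lborel (?f n)) \<longlonglongrightarrow> l"
    using filterlim_compose[OF lim flim] by (simp add: set_lebesgue_integral_def)
  have mono: "AE y in lborel. mono (\<lambda>n. ?f n y)"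
  proof (rule AE_I2, rule monoI)
    fix y m n assume "m \<le> (n::nat)"
    then show "?f m y \<le> ?f n y" using dec[of m n] g0[of y] by (auto simp: indicator_def)
  qed
  show "set_integrable lborel (S - {x}) g" unfolding set_integrable_def
    by (rule integrable_monotone_convergence[OF fi mono _ fl um]) (use conv in auto)
  show "(LINT y:(S - {x})|lborel. g y) = l" unfolding set_lebesgue_integral_def
    by (rule integral_monotone_convergence[OF fi mono _ fl um]) (use conv in auto)
qed

lemma polynomial_deg_le_continuous: "polynomial_deg_le n p \<Longrightarrow> continuous_on A p"
  by (induction rule: polynomial_deg_le.induct) (auto intro!: continuous_intros)

section \<open>The extended domain and the fourth-order sup norm\<close>

lemma extended_domain_eq_Union_balls:
  assumes "0 < \<epsilon>" shows "extended_domain \<Omega> \<epsilon> = (\<Union>x\<in>\<Omega>. ball x \<epsilon>)"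
  using assms by (auto simp: extended_domain_def interaction_domain_def dist_norm norm_minus_commute
      intro!: bexI)

lemma open_extended_domain: "0 < \<epsilon> \<Longrightarrow> open (extended_domain \<Omega> \<epsilon>)"
  by (auto simp: extended_domain_eq_Union_balls)

lemma bounded_extended_domain:
  assumes "0 < \<epsilon>" "bounded \<Omega>" shows "bounded (extended_domain \<Omega> \<epsilon>)"
proof -
  obtain B where B: "\<And>x. x \<in> \<Omega> \<Longrightarrow> norm x \<le> B" using assms(2) by (auto simp: bounded_iff)
  have "norm y \<le> B + \<epsilon>" if "y \<in> extended_domain \<Omega> \<epsilon>" for y
  proof -
    obtain x where "x \<in> \<Omega>" "dist x y < \<epsilon>"
      using \<open>y \<in> extended_domain \<Omega> \<epsilon>\<close> assms(1) by (auto simp: extended_domain_eq_Union_balls)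
    then show ?thesis using B[of x] norm_triangle_ineq2[of y x] by (auto simp: dist_norm norm_minus_commute)
  qed
  then show ?thesis by (auto simp: bounded_iff)
qed

text \<open>A real \<open>Sup\<close> is meaningful only for a set bounded above. There are finitely
  many index lists, and each derivative agrees on \<open>S\<close> with a continuous function on the
  compact closure.\<close>

lemma bdd_above_D4:
  fixes S :: "'a::euclidean_space set"
  assumes "Ck_upto_boundary 4 S f" "bounded S"
  shows "bdd_above (insert 0
    {\<bar>partial_derivs bs f x\<bar> | bs x. set bs \<subseteq> Basis \<and> length bs = 4 \<and> x \<in> S})"
proof -
  let ?L = "{bs. set bs \<subseteq> (Basis :: 'a set) \<and> length bs = 4}"
  have comp: "compact (closure S)" using assms(2) by simp
  have "\<exists>B. \<forall>x\<in>S. \<bar>partial_derivs bs f x\<bar> \<le> B" if bs: "bs \<in> ?L" for bs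
  proof -
    obtain g where g: "continuous_on (closure S) g" "\<And>x. x \<in> S \<Longrightarrow> g x = partial_derivs bs f x"
      using assms(1) bs unfolding Ck_upto_boundary_def by auto
    have "bounded (g ` closure S)"
      by (intro compact_imp_bounded compact_continuous_image g comp)
    then obtain B where "\<And>x. x \<in> closure S \<Longrightarrow> \<bar>g x\<bar> \<le> B" by (auto simp: bounded_iff)
    then show ?thesis using g(2) closure_subset[of S] by (metis subsetD)
  qed
  then obtain B where B: "\<And>bs x. bs \<in> ?L \<Longrightarrow> x \<in> S \<Longrightarrow> \<bar>partial_derivs bs f x\<bar> \<le> B bs" by metis
  have fin: "finite ?L" by (rule finite_lists_length_eq) simp
  show ?thesis
  proof (rule bdd_aboveI[of _ "Max (insert 0 (B ` ?L))"])
    fix v assume "v \<in> insert 0 {\<bar>partial_derivs bs f x\<bar> | bs x. set bs \<subseteq> Basis \<and> length bs = 4 \<and> x \<in> S}"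
    then show "v \<le> Max (insert 0 (B ` ?L))"
      using fin B by (subst Max_ge_iff) auto
  qed
qed

lemma abs_partial_derivs_le_D4_sup_norm:
  fixes S :: "'a::euclidean_space set"
  assumes "Ck_upto_boundary 4 S f" "bounded S" "set bs \<subseteq> Basis" "length bs = 4" "x \<in> S"
  shows "\<bar>partial_derivs bs f x\<bar> \<le> D4_sup_norm S f"
  unfolding D4_sup_norm_def
  by (intro cSup_upper bdd_above_D4) (use assms in auto)

lemma D4_sup_norm_nonneg:
  assumes "Ck_upto_boundary 4 S f" "bounded S" shows "0 \<le> D4_sup_norm S f"
  unfolding D4_sup_norm_def by (intro cSup_upper bdd_above_D4) (use assms in auto)

lemma nl_kernel_measurable:
  assumes "nl_kernel \<Omega> \<epsilon> \<alpha> \<gamma>"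
  shows "(\<lambda>p. \<gamma> (fst p) (snd p)) \<in> borel_measurable borel"
proof -
  have [measurable]: "(\<lambda>p. \<alpha> (fst p) (snd p)) \<in> borel_measurable borel"
    and eq: "\<gamma> = (\<lambda>x y. \<alpha> x y \<bullet> \<alpha> x y)"
    using assms by (auto simp: nl_kernel_def fun_eq_iff)
  show ?thesis unfolding eq by measurable
qed

lemma has_nl_laplacian_unique:
  "has_nl_laplacian S \<gamma> w x l \<Longrightarrow> has_nl_laplacian S \<gamma> w x l' \<Longrightarrow> l = l'"
  unfolding has_nl_laplacian_def by (auto intro: tendsto_unique[OF trivial_limit_at_right_real])

lemma nl_laplacian_eq: "has_nl_laplacian S \<gamma> w x l \<Longrightarrow> nl_laplacian S \<gamma> w x = l"
  unfolding nl_laplacian_def by (auto intro: has_nl_laplacian_unique)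

text \<open>Existence of the principal value is a conclusion: it splits into that of the Taylor
  polynomial, supplied by exactness, and an absolutely convergent integral of the remainder.\<close>

lemma nl_laplacian_consistency:
  fixes \<Omega> :: "'a::euclidean_space set"
  assumes "0 < \<epsilon>" "bounded \<Omega>" "nl_kernel \<Omega> \<epsilon> \<alpha> \<gamma>" "x \<in> \<Omega>"
    and exact: "\<And>p. polynomial_deg_le 3 p \<Longrightarrow>
        has_nl_laplacian (extended_domain \<Omega> \<epsilon>) \<gamma> p x (laplacian p x)"
    and w: "Ck_upto_boundary 4 (extended_domain \<Omega> \<epsilon>) w"
  shows "has_nl_laplacian (extended_domain \<Omega> \<epsilon>) \<gamma> w x (nl_laplacian (extended_domain \<Omega> \<epsilon>) \<gamma> w x)"
    and "\<bar>nl_laplacian (extended_domain \<Omega> \<epsilon>) \<gamma> w x - laplacian w x\<bar>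
      \<le> real DIM('a) ^ 5 / 12 * \<epsilon>\<^sup>2 * D4_sup_norm (extended_domain \<Omega> \<epsilon>) w"
proof -
  define S where "S = extended_domain \<Omega> \<epsilon>"
  define M where "M = D4_sup_norm S w"
  \<comment> \<open>Of the four powers of |y - x| in the remainder, two become \<epsilon>^2 because
    the kernel has range \<epsilon>; the other two go into the second-moment density
    \<open>q\<close>.\<close>
  define K where "K = real DIM('a) ^ 4 / 24 * M * \<epsilon>\<^sup>2"
  define P where "P = taylor3 w x"
  define r where "r = (\<lambda>y. (w y - P y) * \<gamma> x y)"
  define q where "q = (\<lambda>y. (norm (y - x))\<^sup>2 * \<gamma> x y)"
  have S: "open S" "bounded S" using assms by (simp_all add: S_def open_extended_domain bounded_extended_domain)
  have ball: "ball x \<epsilon> \<subseteq> S" using assms by (auto simp: S_def extended_domain_eq_Union_balls)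
  have SB [measurable]: "S \<in> sets borel" using S by simp
  have \<gamma>0: "0 \<le> \<gamma> x y" for y using assms(3) by (simp add: nl_kernel_def)
  have far: "\<gamma> x y = 0" if "y \<in> S" "\<epsilon> \<le> norm (x - y)" for y
    using assms(3,4) that unfolding nl_kernel_def S_def by blast
  have [measurable]: "(\<lambda>y. \<gamma> x y) \<in> borel_measurable borel"
    using measurable_compose[OF _ nl_kernel_measurable[OF assms(3)], of "\<lambda>y. (x, y)" borel] by simp
  have [measurable]: "P \<in> borel_measurable borel" unfolding P_def
    using polynomial_deg_le_continuous[OF polynomial_deg_le_taylor3]
    by (intro borel_measurable_continuous_onI)
  have Px: "P x = w x" by (simp add: P_def taylor3_self)
  have M0: "0 \<le> M" unfolding M_def by (rule D4_sup_norm_nonneg) (use w S in \<open>auto simp: S_def\<close>)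
  \<comment> \<open>Within range the segment stays in \<open>ball x \<epsilon>\<close>, a subset of
    \<open>S\<close>; out of range the kernel vanishes.\<close>
  have r_le: "\<bar>r y\<bar> \<le> K * q y" if y: "y \<in> S" for y
  proof (cases "norm (x - y) < \<epsilon>")
    case True
    then have seg: "closed_segment x y \<subseteq> ball x \<epsilon>"
      by (intro closed_segment_subset) (auto simp: dist_norm assms(1))
    have n: "norm (y - x) \<le> \<epsilon>" using True by (simp add: norm_minus_commute)
    have "\<bar>w y - P y\<bar> \<le> real DIM('a) ^ 4 / 24 * M * norm (y - x) ^ 4"
      unfolding P_def
    proof (rule taylor3_remainder)
      fix bs z assume bs: "set bs \<subseteq> (Basis :: 'a set)" and z: "z \<in> closed_segment x y"
      have zS: "z \<in> S" using z seg ball by auto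
      show "partial_derivs bs w differentiable (at z)" if "length bs < 4"
        using w bs that zS S(1) unfolding Ck_upto_boundary_def S_def[symmetric]
        by (auto simp: differentiable_on_eq_differentiable_at)
      show "\<bar>partial_derivs bs w z\<bar> \<le> M" if "length bs = 4"
        unfolding M_def
        by (rule abs_partial_derivs_le_D4_sup_norm) (use w bs that zS S in \<open>auto simp: S_def\<close>)
    qed
    also have "norm (y - x) ^ 4 = (norm (y - x))\<^sup>2 * (norm (y - x))\<^sup>2"
      by (simp flip: power_add)
    also have "real DIM('a) ^ 4 / 24 * M * \<dots> \<le> real DIM('a) ^ 4 / 24 * M * (\<epsilon>\<^sup>2 * (norm (y - x))\<^sup>2)"
      using n M0 by (intro mult_left_mono mult_right_mono power_mono) auto
    finally have "\<bar>w y - P y\<bar> \<le> K * (norm (y - x))\<^sup>2" by (simp add: K_def mult_ac)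
    then show ?thesis using mult_right_mono[OF _ \<gamma>0[of y]]
      by (fastforce simp: r_def q_def abs_mult \<gamma>0 mult.assoc)
  next
    case False
    then show ?thesis using far[OF y] by (simp add: r_def q_def)
  qed
  have q: "has_nl_laplacian S \<gamma> (\<lambda>y. (norm (y - x))\<^sup>2) x (2 * real DIM('a))"
    using exact[OF polynomial_deg_le_mono[OF polynomial_deg_le_dist_power2, of 3 x]]
    by (simp add: S_def laplacian_dist_power2)
  have q_int: "set_integrable lborel (S - ball x \<delta>) q" if "0 < \<delta>" for \<delta>
    using q that by (auto simp: has_nl_laplacian_def q_def)
  have q_lim: "((\<lambda>\<delta>. 2 * (LINT y:(S - ball x \<delta>)|lborel. q y)) \<longlongrightarrow> 2 * real DIM('a)) (at_right 0)"
    using q by (auto simp: has_nl_laplacian_def q_def)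
  have q_lim: "((\<lambda>\<delta>. LINT y:(S - ball x \<delta>)|lborel. q y) \<longlongrightarrow> real DIM('a)) (at_right 0)"
    using tendsto_divide[OF q_lim tendsto_const[of 2]] by simp
  have q_nonneg: "0 \<le> q y" for y by (simp add: q_def \<gamma>0)
  \<comment> \<open>Monotone convergence turns the limit into an integrable majorant whose total
    mass is the dimension.\<close>
  note q_total = truncation_limit_nonneg[OF SB q_nonneg q_int q_lim]
  have w_cont: "continuous_on S w"
    using w closure_subset[of S] unfolding Ck_upto_boundary_def S_def by (blast intro: continuous_on_subset)
  have [measurable]: "(\<lambda>y. indicator S y * w y) \<in> borel_measurable borel"
    using borel_measurable_continuous_on_indicator[OF SB w_cont] by simp
  have "(\<lambda>y. (indicator S y * w y - indicator S y * P y) * \<gamma> x y) \<in> borel_measurable borel"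
    by measurable
  then have r_meas: "set_borel_measurable lborel S r"
    by (simp add: set_borel_measurable_def r_def algebra_simps)
  have Kq: "set_integrable lborel (S - {x}) (\<lambda>y. K * q y)" using q_total(1) by simp
  define I where "I = (LINT y:(S - {x})|lborel. r y)"
  have r_int: "set_integrable lborel (S - ball x \<delta>) r" if "0 < \<delta>" for \<delta>
    by (rule truncation_limit_dominated(2)[OF SB Kq r_meas]) (use r_le that in auto)
  have r_lim: "((\<lambda>\<delta>. LINT y:(S - ball x \<delta>)|lborel. r y) \<longlongrightarrow> I) (at_right 0)"
    unfolding I_def by (rule truncation_limit_dominated(1)[OF SB Kq r_meas]) (use r_le in auto)
  have r_int0: "set_integrable lborel (S - {x}) r"
    by (rule truncation_limit_dominated(2)[OF SB Kq r_meas]) (use r_le in auto)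
  have "\<bar>I\<bar> \<le> (LINT y:(S - {x})|lborel. \<bar>r y\<bar>)"
    using set_integral_norm_bound[OF r_int0] by (simp add: I_def)
  also have "\<dots> \<le> (LINT y:(S - {x})|lborel. K * q y)"
    using r_le by (intro set_integral_mono set_integrable_abs r_int0 Kq) auto
  also have "\<dots> = K * real DIM('a)" using q_total(2) by simp
  finally have I_le: "\<bar>I\<bar> \<le> K * real DIM('a)" .
  have P: "has_nl_laplacian S \<gamma> P x (laplacian w x)"
    using exact[OF polynomial_deg_le_taylor3[of w x]] by (simp add: S_def P_def laplacian_taylor3)
  have split: "(\<lambda>y. (w y - w x) * \<gamma> x y) = (\<lambda>y. (P y - P x) * \<gamma> x y + r y)"
    by (auto simp: r_def Px algebra_simps)
  \<comment> \<open>The polynomial part converges as a principal value, the remainder absolutely;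
    the sum gives both the existence and the error term \<open>2 * I\<close>.\<close>
  have L: "has_nl_laplacian S \<gamma> w x (laplacian w x + 2 * I)"
    unfolding has_nl_laplacian_def split
  proof (intro conjI allI impI)
    have P_int: "set_integrable lborel (S - ball x \<delta>) (\<lambda>y. (P y - P x) * \<gamma> x y)" if "0 < \<delta>" for \<delta>
      using P that by (simp add: has_nl_laplacian_def)
    show "set_integrable lborel (S - ball x \<delta>) (\<lambda>y. (P y - P x) * \<gamma> x y + r y)" if "0 < \<delta>" for \<delta>
      using P_int r_int that by (intro set_integral_add)
    have "((\<lambda>\<delta>. 2 * (LINT y:(S - ball x \<delta>)|lborel. (P y - P x) * \<gamma> x y)
        + 2 * (LINT y:(S - ball x \<delta>)|lborel. r y)) \<longlongrightarrow> laplacian w x + 2 * I) (at_right 0)"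
      using P by (intro tendsto_add tendsto_mult tendsto_const r_lim) (simp add: has_nl_laplacian_def)
    moreover have "\<forall>\<^sub>F \<delta> in at_right 0. 2 * (LINT y:(S - ball x \<delta>)|lborel. (P y - P x) * \<gamma> x y)
        + 2 * (LINT y:(S - ball x \<delta>)|lborel. r y)
        = 2 * (LINT y:(S - ball x \<delta>)|lborel. (P y - P x) * \<gamma> x y + r y)"
      using eventually_at_right_less[of 0]
      by eventually_elim (simp add: set_integral_add(2)[OF P_int r_int])
    ultimately show "((\<lambda>\<delta>. 2 * (LINT y:(S - ball x \<delta>)|lborel. (P y - P x) * \<gamma> x y + r y))
        \<longlongrightarrow> laplacian w x + 2 * I) (at_right 0)"
      by (rule Lim_transform_eventually)
  qed
  have eq: "nl_laplacian S \<gamma> w x = laplacian w x + 2 * I" by (rule nl_laplacian_eq[OF L])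
  show "has_nl_laplacian (extended_domain \<Omega> \<epsilon>) \<gamma> w x (nl_laplacian (extended_domain \<Omega> \<epsilon>) \<gamma> w x)"
    using L eq by (simp add: S_def)
  show "\<bar>nl_laplacian (extended_domain \<Omega> \<epsilon>) \<gamma> w x - laplacian w x\<bar>
      \<le> real DIM('a) ^ 5 / 12 * \<epsilon>\<^sup>2 * D4_sup_norm (extended_domain \<Omega> \<epsilon>) w"
    using I_le unfolding S_def[symmetric] M_def[symmetric] eq
    by (simp add: K_def power_numeral_reduce field_simps)
qed

section \<open>The energy space\<close>

text \<open>One function on the product space, with the domain built in through indicators, so that
  Tonelli and Fubini can replace the iterated integrals by a single one.\<close>

definition nl_integrand ::
    "'a set \<Rightarrow> ('a \<Rightarrow> 'a \<Rightarrow> real) \<Rightarrow> ('a \<Rightarrow> real) \<Rightarrow> ('a \<Rightarrow> real) \<Rightarrow> 'a \<times> 'a \<Rightarrow> real" where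
  "nl_integrand S \<gamma> w z p = indicator S (fst p) * (indicator S (snd p) *
     ((w (fst p) - w (snd p)) * (z (fst p) - z (snd p)) * \<gamma> (fst p) (snd p)))"

lemma nl_integrand_measurable:
  fixes w z :: "'a::euclidean_space \<Rightarrow> real"
  assumes S [measurable]: "S \<in> sets borel" and w: "set_borel_measurable lborel S w"
    and z: "set_borel_measurable lborel S z"
    and \<gamma>: "(\<lambda>p. \<gamma> (fst p) (snd p)) \<in> borel_measurable borel"
  shows "nl_integrand S \<gamma> w z \<in> borel_measurable (lborel \<Otimes>\<^sub>M lborel)"
proof -
  have [measurable]: "(\<lambda>x. indicator S x * w x) \<in> borel_measurable borel"
      "(\<lambda>x. indicator S x * z x) \<in> borel_measurable borel"
    using w z by (simp_all add: set_borel_measurable_def)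
  have [measurable]: "(\<lambda>p. \<gamma> (fst p) (snd p)) \<in> borel_measurable (borel \<Otimes>\<^sub>M borel)"
    using \<gamma> by (simp add: borel_prod)
  \<comment> \<open>\<open>w\<close> and \<open>z\<close> are measurable only on \<open>S\<close>,
    so each of their values is paired with the indicator of its own argument.\<close>
  have eq: "nl_integrand S \<gamma> w z = (\<lambda>p.
      (indicator S (fst p) * w (fst p) * indicator S (snd p)
        - indicator S (snd p) * w (snd p) * indicator S (fst p)) *
      (indicator S (fst p) * z (fst p) * indicator S (snd p)
        - indicator S (snd p) * z (snd p) * indicator S (fst p)) * \<gamma> (fst p) (snd p))"
    by (auto simp: nl_integrand_def indicator_def)
  have "\<dots> \<in> borel_measurable (borel \<Otimes>\<^sub>M borel)" by measurable
  then show ?thesis unfolding eq by (simp cong: measurable_cong_sets)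
qed

lemma nl_integrand_nonneg: "(\<And>x y. 0 \<le> \<gamma> x y) \<Longrightarrow> 0 \<le> nl_integrand S \<gamma> w w p"
  by (simp add: nl_integrand_def)

lemma nl_energy_eq:
  fixes v :: "'a::euclidean_space \<Rightarrow> real"
  assumes S: "S \<in> sets borel" and v: "set_borel_measurable lborel S v"
    and k: "nl_kernel \<Omega> \<epsilon> \<alpha> \<gamma>"
  shows "nl_energy S \<alpha> v = (\<integral>\<^sup>+p. ennreal (nl_integrand S \<gamma> v v p) \<partial>(lborel \<Otimes>\<^sub>M lborel)) / 2"
proof -
  have \<gamma>: "\<And>x y. \<gamma> x y = \<alpha> x y \<bullet> \<alpha> x y" using k by (simp add: nl_kernel_def)
  have "(\<integral>\<^sup>+y\<in>S. ennreal ((norm (nl_gradient \<alpha> v x y))\<^sup>2) \<partial>lborel) * indicator S x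
      = (\<integral>\<^sup>+y. ennreal (nl_integrand S \<gamma> v v (x, y)) \<partial>lborel)" for x
  proof (cases "x \<in> S")
    case True
    have "ennreal ((norm (nl_gradient \<alpha> v x y))\<^sup>2) * indicator S y
        = ennreal (nl_integrand S \<gamma> v v (x, y))" for y
      using True by (simp add: nl_integrand_def nl_gradient_def \<gamma> power2_norm_eq_inner
          indicator_def algebra_simps)
    then show ?thesis using True by simp
  qed (simp add: nl_integrand_def)
  then show ?thesis unfolding nl_energy_def
    using nl_integrand_measurable[OF S v v nl_kernel_measurable[OF k]]
    by (simp add: lborel.nn_integral_fst[of "\<lambda>p. ennreal (nl_integrand S \<gamma> v v p)"])
qed

text \<open>For a nonnegative measurable integrand, finite energy is integrability on the product,
  by Tonelli.\<close>

lemma energy_space_iff: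
  fixes v :: "'a::euclidean_space \<Rightarrow> real"
  assumes S: "S \<in> sets borel" and k: "nl_kernel \<Omega> \<epsilon> \<alpha> \<gamma>"
  shows "v \<in> energy_space S \<alpha> \<longleftrightarrow>
    square_integrable_on lborel S v \<and> integrable (lborel \<Otimes>\<^sub>M lborel) (nl_integrand S \<gamma> v v)"
proof (cases "square_integrable_on lborel S v")
  case True
  then have v: "set_borel_measurable lborel S v" by (simp add: square_integrable_on_def)
  have \<gamma>: "\<And>x y. 0 \<le> \<gamma> x y" using k by (simp add: nl_kernel_def)
  show ?thesis
    using True nl_integrand_measurable[OF S v v nl_kernel_measurable[OF k]] nl_integrand_nonneg[of \<gamma> S v, OF \<gamma>]
    by (simp add: energy_space_def nl_energy_eq[OF S v k] integrable_iff_bounded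
        ennreal_divide_eq_top_iff less_top[symmetric])
qed (simp add: energy_space_def)

text \<open>Membership makes the energy finite, so \<open>enn2real\<close> loses nothing; the factor
  2 undoes the one half in the energy.\<close>

lemma energy_norm_power2:
  fixes v :: "'a::euclidean_space \<Rightarrow> real"
  assumes S: "S \<in> sets borel" and k: "nl_kernel \<Omega> \<epsilon> \<alpha> \<gamma>" and v: "v \<in> energy_space S \<alpha>"
  shows "2 * (energy_norm S \<alpha> v)\<^sup>2 = integral\<^sup>L (lborel \<Otimes>\<^sub>M lborel) (nl_integrand S \<gamma> v v)"
proof -
  have \<gamma>: "\<And>x y. 0 \<le> \<gamma> x y" using k by (simp add: nl_kernel_def)
  have vm: "set_borel_measurable lborel S v" and int: "integrable (lborel \<Otimes>\<^sub>M lborel) (nl_integrand S \<gamma> v v)"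
    using v energy_space_iff[OF S k] by (auto simp: square_integrable_on_def)
  let ?I = "integral\<^sup>L (lborel \<Otimes>\<^sub>M lborel) (nl_integrand S \<gamma> v v)"
  have I0: "0 \<le> ?I" using nl_integrand_nonneg[of \<gamma> S v, OF \<gamma>] by (simp add: integral_nonneg_AE)
  have "nl_energy S \<alpha> v = ennreal ?I / 2"
    using int nl_integrand_nonneg[of \<gamma> S v, OF \<gamma>]
    by (simp add: nl_energy_eq[OF S vm k] nn_integral_eq_integral)
  also have "\<dots> = ennreal (?I / 2)" using I0 by (simp add: ennreal_divide_numeral)
  finally show ?thesis using I0 by (simp add: energy_norm_def)
qed

text \<open>The bound |ab| \<le> a^2 + b^2 for the two increments, weighted by the kernel.\<close>

lemma nl_integrand_integrable:
  fixes w z :: "'a::euclidean_space \<Rightarrow> real"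
  assumes S: "S \<in> sets borel" and k: "nl_kernel \<Omega> \<epsilon> \<alpha> \<gamma>"
    and w: "w \<in> energy_space S \<alpha>" and z: "z \<in> energy_space S \<alpha>"
  shows "integrable (lborel \<Otimes>\<^sub>M lborel) (nl_integrand S \<gamma> w z)"
proof (rule Bochner_Integration.integrable_bound)
  have \<gamma>: "\<And>x y. 0 \<le> \<gamma> x y" using k by (simp add: nl_kernel_def)
  show "integrable (lborel \<Otimes>\<^sub>M lborel) (\<lambda>p. nl_integrand S \<gamma> w w p + nl_integrand S \<gamma> z z p)"
    using w z energy_space_iff[OF S k] by auto
  show "nl_integrand S \<gamma> w z \<in> borel_measurable (lborel \<Otimes>\<^sub>M lborel)"
    using w z energy_space_iff[OF S k]
    by (intro nl_integrand_measurable S nl_kernel_measurable[OF k]) (auto simp: square_integrable_on_def)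
  have ab: "\<bar>a * b\<bar> * c \<le> a * a * c + b * b * c" if "0 \<le> c" for a b c :: real
  proof -
    have "2 * (\<bar>a\<bar> * \<bar>b\<bar>) \<le> a * a + b * b"
      using sum_squares_bound[of "\<bar>a\<bar>" "\<bar>b\<bar>"] by (simp add: power2_eq_square)
    moreover have "0 \<le> \<bar>a\<bar> * \<bar>b\<bar>" by (intro mult_nonneg_nonneg abs_ge_zero)
    ultimately have "\<bar>a * b\<bar> \<le> a * a + b * b" unfolding abs_mult by linarith
    then show ?thesis using mult_right_mono[OF _ that] by (simp flip: distrib_right)
  qed
  show "AE p in lborel \<Otimes>\<^sub>M lborel. norm (nl_integrand S \<gamma> w z p)
      \<le> norm (nl_integrand S \<gamma> w w p + nl_integrand S \<gamma> z z p)"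
  proof (rule AE_I2)
    fix p
    have "\<bar>nl_integrand S \<gamma> w z p\<bar> \<le> nl_integrand S \<gamma> w w p + nl_integrand S \<gamma> z z p"
      using ab[OF \<gamma>] by (auto simp: nl_integrand_def indicator_def abs_mult \<gamma>)
    then show "norm (nl_integrand S \<gamma> w z p)
      \<le> norm (nl_integrand S \<gamma> w w p + nl_integrand S \<gamma> z z p)" by simp
  qed
qed

text \<open>Fubini. The product form is what makes additivity safe, since an iterated Bochner
  integral takes the default value 0 where an inner integral does not exist.\<close>

lemma nl_form_eq:
  fixes w z :: "'a::euclidean_space \<Rightarrow> real"
  assumes "S \<in> sets borel" "nl_kernel \<Omega> \<epsilon> \<alpha> \<gamma>" "w \<in> energy_space S \<alpha>" "z \<in> energy_space S \<alpha>"
  shows "nl_form S \<gamma> w z = integral\<^sup>L (lborel \<Otimes>\<^sub>M lborel) (nl_integrand S \<gamma> w z)"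
  unfolding lborel_pair.integral_fst'[OF nl_integrand_integrable[OF assms], symmetric]
  by (simp add: nl_form_def set_lebesgue_integral_def nl_integrand_def)

lemma energy_space_diff:
  fixes w z :: "'a::euclidean_space \<Rightarrow> real"
  assumes S: "S \<in> sets borel" and k: "nl_kernel \<Omega> \<epsilon> \<alpha> \<gamma>"
    and w: "w \<in> energy_space S \<alpha>" and z: "z \<in> energy_space S \<alpha>"
  shows "(\<lambda>x. w x - z x) \<in> energy_space S \<alpha>"
  unfolding energy_space_iff[OF S k]
proof
  have sq: "square_integrable_on lborel S w" "square_integrable_on lborel S z"
    using w z energy_space_iff[OF S k] by auto
  have m: "set_borel_measurable lborel S (\<lambda>x. w x - z x)"
    using sq by (auto simp: square_integrable_on_def set_borel_measurable_def right_diff_distrib)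
  have i: "set_integrable lborel S (\<lambda>x. 2 * (w x)\<^sup>2 + 2 * (z x)\<^sup>2)"
    using sq by (intro set_integral_add set_integrable_mult_right) (auto simp: square_integrable_on_def)
  have "set_integrable lborel S (\<lambda>x. (w x - z x)\<^sup>2)"
  proof (rule set_integrable_bound[OF i])
    have "(\<lambda>x. (indicator S x *\<^sub>R (w x - z x))\<^sup>2) \<in> borel_measurable lborel"
      using m unfolding set_borel_measurable_def by measurable
    moreover have "(\<lambda>x. (indicator S x *\<^sub>R (w x - z x))\<^sup>2) = (\<lambda>x. indicator S x *\<^sub>R (w x - z x)\<^sup>2)"
      by (auto simp: indicator_def)
    ultimately show "set_borel_measurable lborel S (\<lambda>x. (w x - z x)\<^sup>2)"
      by (simp add: set_borel_measurable_def)
    have "(a - b)\<^sup>2 \<le> 2 * a\<^sup>2 + 2 * b\<^sup>2" for a b :: real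
      using zero_le_power2[of "a + b"] by (simp add: power2_eq_square algebra_simps)
    then show "AE x in lborel. x \<in> S \<longrightarrow> norm ((w x - z x)\<^sup>2) \<le> norm (2 * (w x)\<^sup>2 + 2 * (z x)\<^sup>2)"
      by simp
  qed
  then show "square_integrable_on lborel S (\<lambda>x. w x - z x)" using m by (simp add: square_integrable_on_def)
  have "nl_integrand S \<gamma> (\<lambda>x. w x - z x) (\<lambda>x. w x - z x) =
      (\<lambda>p. nl_integrand S \<gamma> w w p - 2 * nl_integrand S \<gamma> w z p + nl_integrand S \<gamma> z z p)"
    by (auto simp: nl_integrand_def algebra_simps)
  then show "integrable (lborel \<Otimes>\<^sub>M lborel) (nl_integrand S \<gamma> (\<lambda>x. w x - z x) (\<lambda>x. w x - z x))"
    using nl_integrand_integrable[OF S k] w z by simp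
qed

lemma nl_form_diff_left:
  fixes w z e :: "'a::euclidean_space \<Rightarrow> real"
  assumes S: "S \<in> sets borel" and k: "nl_kernel \<Omega> \<epsilon> \<alpha> \<gamma>"
    and w: "w \<in> energy_space S \<alpha>" and z: "z \<in> energy_space S \<alpha>" and e: "e \<in> energy_space S \<alpha>"
  shows "nl_form S \<gamma> (\<lambda>x. w x - z x) e = nl_form S \<gamma> w e - nl_form S \<gamma> z e"
proof -
  have "nl_integrand S \<gamma> (\<lambda>x. w x - z x) e = (\<lambda>p. nl_integrand S \<gamma> w e p - nl_integrand S \<gamma> z e p)"
    by (auto simp: nl_integrand_def algebra_simps)
  then show ?thesis
    using nl_integrand_integrable[OF S k] assms energy_space_diff[OF S k w z]
    by (simp add: nl_form_eq[OF S k])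
qed

section \<open>Integrability and measurability behind the error identity\<close>

text \<open>Young's inequality 2|a| \<le> t a^2 + 1/t, integrated over \<Omega>; the constant term
  yields the volume divided by \<open>t\<close>. The weight stays free so that it can be matched to
  the size of the error.\<close>

lemma L1_le_L2:
  fixes e :: "'a::euclidean_space \<Rightarrow> real"
  assumes S: "S \<in> sets borel" and \<Omega>: "\<Omega> \<in> sets borel" "\<Omega> \<subseteq> S" "bounded \<Omega>"
    and e: "square_integrable_on lborel S e" and t: "0 < t"
  shows "set_integrable lborel \<Omega> e"
    and "2 * (LINT x:\<Omega>|lborel. \<bar>e x\<bar>) \<le> t * (L2_norm_on S e)\<^sup>2 + measure lborel \<Omega> / t"
proof -
  have e2: "set_integrable lborel S (\<lambda>x. (e x)\<^sup>2)" and m: "set_borel_measurable lborel \<Omega> e"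
    using e \<Omega> by (auto simp: square_integrable_on_def intro: set_borel_measurable_subset)
  have fin: "emeasure lborel \<Omega> < \<infinity>" using \<Omega>(3) by (rule emeasure_bounded_finite)
  have c: "set_integrable lborel \<Omega> (\<lambda>x. c)" for c :: real
    using \<Omega> fin by (simp add: set_integrable_def)
  have e2\<Omega>: "set_integrable lborel \<Omega> (\<lambda>x. (e x)\<^sup>2)"
    by (rule set_integrable_subset[OF e2]) (use \<Omega> in auto)
  have b: "set_integrable lborel \<Omega> (\<lambda>x. t * (e x)\<^sup>2 + 1 / t)"
    using e2\<Omega> c by (intro set_integral_add) auto
  have young: "2 * \<bar>a\<bar> \<le> t * a\<^sup>2 + 1 / t" for a
  proof -
    have "0 \<le> (t * \<bar>a\<bar> - 1)\<^sup>2 / t" using t by simp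
    also have "\<dots> = t * a\<^sup>2 - 2 * \<bar>a\<bar> + 1 / t"
      using t by (simp add: power2_eq_square field_simps)
    finally show ?thesis by simp
  qed
  have "\<bar>a\<bar> \<le> \<bar>t * a\<^sup>2 + 1 / t\<bar>" for a using young[of a] by linarith
  then show i: "set_integrable lborel \<Omega> e"
    by (intro set_integrable_bound[OF b m]) simp
  have "2 * (LINT x:\<Omega>|lborel. \<bar>e x\<bar>) = (LINT x:\<Omega>|lborel. 2 * \<bar>e x\<bar>)" by simp
  also have "\<dots> \<le> (LINT x:\<Omega>|lborel. t * (e x)\<^sup>2 + 1 / t)"
    using young by (intro set_integral_mono b set_integrable_mult_right set_integrable_abs i) auto
  also have "\<dots> = t * (LINT x:\<Omega>|lborel. (e x)\<^sup>2) + measure lborel \<Omega> / t"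
    using e2\<Omega> c fin \<Omega> by (subst set_integral_add) (auto simp: set_lebesgue_integral_def)
  also have "(LINT x:\<Omega>|lborel. (e x)\<^sup>2) \<le> (LINT x:S|lborel. (e x)\<^sup>2)"
    using e2 e2\<Omega> \<Omega> unfolding set_lebesgue_integral_def set_integrable_def
    by (intro integral_mono) (auto simp: indicator_def)
  also have "(LINT x:S|lborel. (e x)\<^sup>2) = (L2_norm_on S e)\<^sup>2"
    unfolding L2_norm_on_def by (simp add: set_lebesgue_integral_def integral_nonneg_AE)
  finally show "2 * (LINT x:\<Omega>|lborel. \<bar>e x\<bar>) \<le> t * (L2_norm_on S e)\<^sup>2 + measure lborel \<Omega> / t"
    using t by simp
qed

text \<open>A pointwise principal value is a limit along the radii 1/(n+1) of truncated integrals,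
  each measurable in \<open>x\<close> as a parameter integral.\<close>

lemma nl_laplacian_measurable:
  fixes w L :: "'a::euclidean_space \<Rightarrow> real"
  assumes [measurable]: "S \<in> sets borel" "\<Omega> \<in> sets borel" and sub: "\<Omega> \<subseteq> S"
    and w: "set_borel_measurable lborel S w"
    and \<gamma>: "(\<lambda>p. \<gamma> (fst p) (snd p)) \<in> borel_measurable borel"
    and L: "\<And>x. x \<in> \<Omega> \<Longrightarrow> has_nl_laplacian S \<gamma> w x (L x)"
  shows "set_borel_measurable lborel \<Omega> L"
proof -
  define \<delta> :: "nat \<Rightarrow> real" where "\<delta> = (\<lambda>n. inverse (real (Suc n)))"
  have flim: "filterlim \<delta> (at_right 0) sequentially"
    unfolding filterlim_at \<delta>_def using LIMSEQ_inverse_real_of_nat by auto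
  have [measurable]: "(\<lambda>x. indicator S x * w x) \<in> borel_measurable borel"
    using w by (simp add: set_borel_measurable_def)
  have [measurable]: "(\<lambda>p. \<gamma> (fst p) (snd p)) \<in> borel_measurable (borel \<Otimes>\<^sub>M borel)"
    using \<gamma> by (simp add: borel_prod)
  \<comment> \<open>Each value of \<open>w\<close> is paired with \<open>indicator S\<close> of its
    argument; for \<open>w (fst p)\<close> this changes nothing, because the factor
    \<open>indicator \<Omega> (fst p)\<close> and \<Omega> \<subseteq> S already force it.\<close>
  define h where "h = (\<lambda>n p. of_bool (\<delta> n \<le> dist (fst p) (snd p)) *
      (indicator \<Omega> (fst p) * (indicator S (snd p) * w (snd p))
        - indicator \<Omega> (fst p) * indicator S (snd p) * (indicator S (fst p) * w (fst p)))
      * \<gamma> (fst p) (snd p))"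
  have "h n \<in> borel_measurable (borel \<Otimes>\<^sub>M borel)" for n
    unfolding h_def by measurable
  then have hm: "h n \<in> borel_measurable (lborel \<Otimes>\<^sub>M lborel)" for n
    by (simp cong: measurable_cong_sets)
  have h_eq: "indicator \<Omega> x * (LINT y:(S - ball x (\<delta> n))|lborel. (w y - w x) * \<gamma> x y) =
      (LINT y|lborel. h n (x, y))" for n x
    unfolding set_lebesgue_integral_def integral_mult_right_zero[symmetric]
    by (rule Bochner_Integration.integral_cong) (use sub in \<open>auto simp: h_def indicator_def algebra_simps\<close>)
  have "(\<lambda>x. indicator \<Omega> x * L x) \<in> borel_measurable lborel"
  proof (rule borel_measurable_LIMSEQ_real)
    show "(\<lambda>x. 2 * (LINT y|lborel. h n (x, y))) \<in> borel_measurable lborel" for n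
      using lborel.borel_measurable_lebesgue_integral[of "\<lambda>x y. h n (x, y)"] hm[of n] by simp
    show "(\<lambda>n. 2 * (LINT y|lborel. h n (x, y))) \<longlonglongrightarrow> indicator \<Omega> x * L x" for x
    proof (cases "x \<in> \<Omega>")
      case True
      have "(\<lambda>n. 2 * (LINT y:(S - ball x (\<delta> n))|lborel. (w y - w x) * \<gamma> x y)) \<longlonglongrightarrow> L x"
        using L[OF True] flim unfolding has_nl_laplacian_def by (auto intro: filterlim_compose)
      then show ?thesis using True by (simp flip: h_eq)
    qed (simp flip: h_eq)
  qed
  then show ?thesis by (simp add: set_borel_measurable_def)
qed

section \<open>Error estimate\<close>

text \<open>Write L e = (s + L) e - s e: the first product has a bounded factor, the second is
  integrable by hypothesis. Thus only the pairing of \<open>s\<close> with \<open>e\<close> enters,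
  and no bound on second derivatives.\<close>

lemma set_integrable_if_bounded_sum:
  fixes L s e :: "'a::euclidean_space \<Rightarrow> real"
  assumes \<Omega>: "\<Omega> \<in> sets borel" and L: "set_borel_measurable lborel \<Omega> L"
    and e: "set_integrable lborel \<Omega> e" and se: "set_integrable lborel \<Omega> (\<lambda>x. s x * e x)"
    and le: "AE x in lborel. x \<in> \<Omega> \<longrightarrow> \<bar>s x + L x\<bar> \<le> \<kappa>"
  shows "set_integrable lborel \<Omega> (\<lambda>x. L x * e x)"
proof -
  have [measurable]: "(\<lambda>x. indicator \<Omega> x * L x) \<in> borel_measurable borel"
      "(\<lambda>x. indicator \<Omega> x * e x) \<in> borel_measurable borel"
    using L borel_measurable_integrable[OF e[unfolded set_integrable_def]]
    by (simp_all add: set_borel_measurable_def)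
  have "(\<lambda>x. (indicator \<Omega> x * L x) * (indicator \<Omega> x * e x)) \<in> borel_measurable borel"
    by measurable
  moreover have "(\<lambda>x. (indicator \<Omega> x * L x) * (indicator \<Omega> x * e x))
      = (\<lambda>x. indicator \<Omega> x *\<^sub>R (L x * e x))" by (auto simp: indicator_def)
  ultimately have m: "set_borel_measurable lborel \<Omega> (\<lambda>x. L x * e x)"
    by (simp add: set_borel_measurable_def)
  have i: "set_integrable lborel \<Omega> (\<lambda>x. \<bar>s x * e x\<bar> + \<kappa> * \<bar>e x\<bar>)"
    using se e by (intro set_integral_add set_integrable_mult_right set_integrable_abs)
  show ?thesis
  proof (rule set_integrable_bound[OF i m])
    show "AE x in lborel. x \<in> \<Omega> \<longrightarrow> norm (L x * e x) \<le> norm (\<bar>s x * e x\<bar> + \<kappa> * \<bar>e x\<bar>)"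
      using le
    proof eventually_elim
      fix x assume *: "x \<in> \<Omega> \<longrightarrow> \<bar>s x + L x\<bar> \<le> \<kappa>"
      have "L x * e x = (s x + L x) * e x - s x * e x" by (simp add: algebra_simps)
      then have "\<bar>L x * e x\<bar> \<le> \<bar>s x * e x\<bar> + \<bar>s x + L x\<bar> * \<bar>e x\<bar>"
        using abs_triangle_ineq4[of "(s x + L x) * e x" "s x * e x"]
        by (simp only: abs_mult add.commute)
      then show "x \<in> \<Omega> \<longrightarrow> norm (L x * e x) \<le> norm (\<bar>s x * e x\<bar> + \<kappa> * \<bar>e x\<bar>)"
        using * mult_right_mono[of "\<bar>s x + L x\<bar>" \<kappa> "\<bar>e x\<bar>"] by auto
    qed
  qed
qed

text \<open>The estimate for one fixed \<epsilon>, with a prefactor of \<epsilon>^2 depending only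
  on the dimension, \<open>c\<close> and the volume of \<Omega>. The 48 is the 12 of the consistency
  bound times 4: a 2 from the energy identity and a 2 from Young's inequality.\<close>

lemma nl_error_estimate:
  fixes \<Omega> :: "'a::euclidean_space set" and \<epsilon> :: real and u w :: "'a \<Rightarrow> real"
  defines "S \<equiv> extended_domain \<Omega> \<epsilon>"
  defines "e \<equiv> \<lambda>x. u x - w x"
  assumes \<epsilon>: "0 < \<epsilon>" and \<Omega>: "open \<Omega>" "bounded \<Omega>" and k: "nl_kernel \<Omega> \<epsilon> \<alpha> \<gamma>"
    and exact: "\<And>p x. polynomial_deg_le 3 p \<Longrightarrow> x \<in> \<Omega> \<Longrightarrow> has_nl_laplacian S \<gamma> p x (laplacian p x)"
    and green: "green_identity \<Omega> \<epsilon> \<alpha> \<gamma>"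
    and w: "Ck_upto_boundary 4 S w" "w \<in> energy_space S \<alpha>"
    and u: "u \<in> energy_space S \<alpha>"
    and vanish: "AE x in lborel. x \<in> interaction_domain \<Omega> \<epsilon> \<longrightarrow> e x = 0"
    and s: "AE x in lborel. x \<in> S \<longrightarrow> - laplacian w x = s x"
    and se: "set_integrable lborel S (\<lambda>x. s x * e x)"
    and weak: "\<And>z. z \<in> energy_space_vanishing S \<alpha> (interaction_domain \<Omega> \<epsilon>) \<Longrightarrow>
        nl_form S \<gamma> u z = (LINT x:\<Omega>|lborel. s x * z x)"
    and poincare: "L2_norm_on S e \<le> c * energy_norm S \<alpha> e"
  shows "energy_norm S \<alpha> e
    \<le> real DIM('a) ^ 5 / 48 * (c\<^sup>2 + measure lborel \<Omega>) * \<epsilon>\<^sup>2 * D4_sup_norm S w"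
proof -
  define \<kappa> where "\<kappa> = real DIM('a) ^ 5 / 12 * \<epsilon>\<^sup>2 * D4_sup_norm S w"
  define E where "E = energy_norm S \<alpha> e"
  define L where "L = nl_laplacian S \<gamma> w"
  have "bounded S" using \<epsilon> \<Omega> by (simp add: S_def bounded_extended_domain)
  then have \<kappa>0: "0 \<le> \<kappa>" using D4_sup_norm_nonneg[OF w(1)] by (simp add: \<kappa>_def)
  have SB: "S \<in> sets borel" and \<Omega>B: "\<Omega> \<in> sets borel" and sub: "\<Omega> \<subseteq> S"
    using open_extended_domain[OF \<epsilon>, of \<Omega>] \<Omega>
    by (simp_all add: S_def) (auto simp: extended_domain_def)
  have eS: "e \<in> energy_space S \<alpha>" unfolding e_def by (rule energy_space_diff[OF SB k u w(2)])
  then have e_sq: "square_integrable_on lborel S e" by (simp add: energy_space_def)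
  have ev: "e \<in> energy_space_vanishing S \<alpha> (interaction_domain \<Omega> \<epsilon>)"
    using eS vanish by (simp add: energy_space_vanishing_def)
  have Lx: "has_nl_laplacian S \<gamma> w x (L x)" "\<bar>L x - laplacian w x\<bar> \<le> \<kappa>" if "x \<in> \<Omega>" for x
    using nl_laplacian_consistency[OF \<epsilon> \<Omega>(2) k that, of w] exact that w(1)
    unfolding S_def \<kappa>_def L_def by auto
  \<comment> \<open>As \<open>s\<close> is minus the Laplacian of \<open>w\<close> almost
    everywhere, \<open>s + L\<close> is the consistency error.\<close>
  have sL: "AE x in lborel. x \<in> \<Omega> \<longrightarrow> \<bar>s x + L x\<bar> \<le> \<kappa>"
    using s
  proof eventually_elim
    fix x assume "x \<in> S \<longrightarrow> - laplacian w x = s x"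
    then show "x \<in> \<Omega> \<longrightarrow> \<bar>s x + L x\<bar> \<le> \<kappa>"
      using Lx(2)[of x] sub by (auto simp: algebra_simps)
  qed
  have wm: "set_borel_measurable lborel S w"
    using w(2) by (simp add: energy_space_def square_integrable_on_def)
  have Lm: "set_borel_measurable lborel \<Omega> L"
    by (rule nl_laplacian_measurable[OF SB \<Omega>B sub wm nl_kernel_measurable[OF k] Lx(1)])
  \<comment> \<open>The weight 1 is arbitrary: only integrability is wanted.\<close>
  have e_int: "set_integrable lborel \<Omega> e"
    by (rule L1_le_L2(1)[OF SB \<Omega>B sub \<Omega>(2) e_sq zero_less_one])
  have se_int: "set_integrable lborel \<Omega> (\<lambda>x. s x * e x)"
    by (rule set_integrable_subset[OF se]) (use \<Omega>B sub in auto)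
  have Le_int: "set_integrable lborel \<Omega> (\<lambda>x. L x * e x)"
    by (rule set_integrable_if_bounded_sum[OF \<Omega>B Lm e_int se_int sL])
  have "2 * E\<^sup>2 = nl_form S \<gamma> e e"
    unfolding E_def by (simp add: energy_norm_power2[OF SB k eS] nl_form_eq[OF SB k eS eS])
  also have "\<dots> = nl_form S \<gamma> u e - nl_form S \<gamma> w e"
    by (subst e_def) (rule nl_form_diff_left[OF SB k u w(2) eS])
  also have "nl_form S \<gamma> u e = (LINT x:\<Omega>|lborel. s x * e x)" by (rule weak[OF ev])
  also have "nl_form S \<gamma> w e = - (LINT x:\<Omega>|lborel. L x * e x)"
    using green w(1) ev unfolding green_identity_def S_def L_def by blast
  also have "(LINT x:\<Omega>|lborel. s x * e x) - - (LINT x:\<Omega>|lborel. L x * e x)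
      = (LINT x:\<Omega>|lborel. s x * e x + L x * e x)"
    using se_int Le_int by simp
  also have "\<dots> \<le> (LINT x:\<Omega>|lborel. \<kappa> * \<bar>e x\<bar>)"
  proof (rule set_integral_mono_AE)
    show "AE x\<in>\<Omega> in lborel. s x * e x + L x * e x \<le> \<kappa> * \<bar>e x\<bar>"
      using sL
    proof eventually_elim
      fix x assume *: "x \<in> \<Omega> \<longrightarrow> \<bar>s x + L x\<bar> \<le> \<kappa>"
      have "s x * e x + L x * e x \<le> \<bar>s x + L x\<bar> * \<bar>e x\<bar>"
        unfolding distrib_right[symmetric] abs_mult[symmetric] by (rule abs_ge_self)
      then show "x \<in> \<Omega> \<longrightarrow> s x * e x + L x * e x \<le> \<kappa> * \<bar>e x\<bar>"
        using * mult_right_mono[of "\<bar>s x + L x\<bar>" \<kappa> "\<bar>e x\<bar>"] by auto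
    qed
  qed (use se_int Le_int e_int in \<open>auto intro!: set_integrable_abs\<close>)
  also have "\<dots> = \<kappa> * (LINT x:\<Omega>|lborel. \<bar>e x\<bar>)" by simp
  finally have E2: "2 * E\<^sup>2 \<le> \<kappa> * (LINT x:\<Omega>|lborel. \<bar>e x\<bar>)" .
  have E0: "0 \<le> E" by (simp add: E_def energy_norm_def)
  have "E \<le> \<kappa> * (c\<^sup>2 + measure lborel \<Omega>) / 4"
  \<comment> \<open>The weight \<open>1 / E\<close> requires a nonzero \<open>E\<close>.\<close>
  proof (cases "E = 0")
    case True
    then show ?thesis using \<kappa>0 by simp
  next
    case False
    then have Epos: "0 < E" using E0 by simp
    \<comment> \<open>Young's inequality with weight \<open>1 / E\<close> replaces Cauchy-Schwarz.\<close>
    have "2 * (LINT x:\<Omega>|lborel. \<bar>e x\<bar>)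
        \<le> (1 / E) * (L2_norm_on S e)\<^sup>2 + measure lborel \<Omega> / (1 / E)"
      by (rule L1_le_L2(2)[OF SB \<Omega>B sub \<Omega>(2) e_sq]) (use Epos in simp)
    \<comment> \<open>Squaring uses only that the left side is nonnegative, so \<open>c\<close> may
      have any sign.\<close>
    also have "(L2_norm_on S e)\<^sup>2 \<le> (c * E)\<^sup>2"
      using poincare unfolding E_def
      by (intro power_mono)
         (auto simp: L2_norm_on_def set_lebesgue_integral_def intro!: integral_nonneg_AE)
    also have "(1 / E) * (c * E)\<^sup>2 + measure lborel \<Omega> / (1 / E) = (c\<^sup>2 + measure lborel \<Omega>) * E"
      using Epos by (simp add: power2_eq_square field_simps)
    finally have I: "2 * (LINT x:\<Omega>|lborel. \<bar>e x\<bar>) \<le> (c\<^sup>2 + measure lborel \<Omega>) * E"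
      using Epos by (simp add: divide_right_mono)
    have "4 * E * E \<le> \<kappa> * (2 * (LINT x:\<Omega>|lborel. \<bar>e x\<bar>))"
      using E2 by (simp add: power2_eq_square)
    also have "\<dots> \<le> \<kappa> * ((c\<^sup>2 + measure lborel \<Omega>) * E)"
      using I \<kappa>0 by (rule mult_left_mono)
    finally have "4 * E * E \<le> \<kappa> * (c\<^sup>2 + measure lborel \<Omega>) * E" by (simp only: mult.assoc)
    then show ?thesis using Epos by simp
  qed
  then show ?thesis by (simp add: E_def \<kappa>_def mult_ac)
qed

theorem mainTheorem3:
  fixes \<Omega> :: "'a::euclidean_space set"
    and \<epsilon>0 :: real
    and \<alpha> :: "real \<Rightarrow> 'a \<Rightarrow> 'a \<Rightarrow> 'a"
    and \<gamma> :: "real \<Rightarrow> 'a \<Rightarrow> 'a \<Rightarrow> real"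
    and \<Omega>N \<Omega>D \<Gamma>N \<Gamma>D :: "real \<Rightarrow> 'a set"
  assumes dim: "DIM('a) \<in> {1, 2, 3}"
    and eps0: "0 < \<epsilon>0"
    and domain: "open \<Omega>" "bounded \<Omega>" "lipschitz_boundary \<Omega>"
    and decomposition:
      "\<And>\<epsilon>. \<epsilon> \<in> {0<..\<epsilon>0} \<Longrightarrow> admissible_decomposition \<Omega> \<epsilon> (\<Omega>N \<epsilon>) (\<Omega>D \<epsilon>) (\<Gamma>N \<epsilon>) (\<Gamma>D \<epsilon>)"
    and kernel: "\<And>\<epsilon>. \<epsilon> \<in> {0<..\<epsilon>0} \<Longrightarrow> nl_kernel \<Omega> \<epsilon> (\<alpha> \<epsilon>) (\<gamma> \<epsilon>)"
    and laplacian_limit: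
      "\<And>w x. Ck_upto_boundary 4 (extended_domain \<Omega> \<epsilon>0) w \<Longrightarrow> x \<in> \<Omega> \<Longrightarrow>
        ((\<lambda>\<epsilon>. nl_laplacian (extended_domain \<Omega> \<epsilon>) (\<gamma> \<epsilon>) w x) \<longlongrightarrow> laplacian w x) (at_right 0)"
    and cubic_exactness:
      "\<And>\<epsilon> p x. \<epsilon> \<in> {0<..\<epsilon>0} \<Longrightarrow> polynomial_deg_le 3 p \<Longrightarrow> x \<in> \<Omega> \<Longrightarrow>
        has_nl_laplacian (extended_domain \<Omega> \<epsilon>) (\<gamma> \<epsilon>) p x (laplacian p x)"
    and C4_in_energy_space:
      "\<And>\<epsilon> w. \<epsilon> \<in> {0<..\<epsilon>0} \<Longrightarrow> Ck_upto_boundary 4 (extended_domain \<Omega> \<epsilon>) w \<Longrightarrow>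
        w \<in> energy_space (extended_domain \<Omega> \<epsilon>) (\<alpha> \<epsilon>)"
    and poincare:
      "\<exists>Cpn. \<forall>\<epsilon>\<in>{0<..\<epsilon>0}.
        \<forall>v\<in>energy_space_vanishing (extended_domain \<Omega> \<epsilon>) (\<alpha> \<epsilon>) (\<Omega>D \<epsilon>).
          L2_norm_on (extended_domain \<Omega> \<epsilon>) v \<le> Cpn * energy_norm (extended_domain \<Omega> \<epsilon>) (\<alpha> \<epsilon>) v"
    and green: "\<And>\<epsilon>. \<epsilon> \<in> {0<..\<epsilon>0} \<Longrightarrow> green_identity \<Omega> \<epsilon> (\<alpha> \<epsilon>) (\<gamma> \<epsilon>)"
  shows "\<exists>C>0. \<forall>\<epsilon>\<in>{0<..\<epsilon>0}. \<forall>s gl vn \<tau> ul u.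
      in_constrained_dual (extended_domain \<Omega> \<epsilon>) (\<alpha> \<epsilon>) (\<Omega>D \<epsilon>) s \<longrightarrow>
      square_integrable_on surface_measure (\<Gamma>N \<epsilon>) gl \<longrightarrow>
      dirichlet_datum (extended_domain \<Omega> \<epsilon>) (\<alpha> \<epsilon>) (\<Omega>D \<epsilon>) (\<Gamma>D \<epsilon>) vn \<tau> \<longrightarrow>
      local_solution (extended_domain \<Omega> \<epsilon>) (\<Gamma>N \<epsilon>) (\<Gamma>D \<epsilon>) s gl \<tau> ul \<longrightarrow>
      (AE x in lborel. x \<in> \<Omega>D \<epsilon> \<longrightarrow> vn x = ul x) \<longrightarrow>
      nl_weak_solution \<Omega> \<epsilon> (\<alpha> \<epsilon>) (\<gamma> \<epsilon>) (\<Omega>N \<epsilon>) (\<Omega>D \<epsilon>) s ul vn u \<longrightarrow>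
      energy_norm (extended_domain \<Omega> \<epsilon>) (\<alpha> \<epsilon>) (\<lambda>x. u x - ul x)
        \<le> C * \<epsilon>\<^sup>2 * D4_sup_norm (extended_domain \<Omega> \<epsilon>) ul \<and>
      L2_norm_on (extended_domain \<Omega> \<epsilon>) (\<lambda>x. u x - ul x)
        \<le> C * \<epsilon>\<^sup>2 * D4_sup_norm (extended_domain \<Omega> \<epsilon>) ul"
proof -
  obtain Cpn where Cpn: "\<And>\<epsilon> v. \<epsilon> \<in> {0<..\<epsilon>0} \<Longrightarrow>
      v \<in> energy_space_vanishing (extended_domain \<Omega> \<epsilon>) (\<alpha> \<epsilon>) (\<Omega>D \<epsilon>) \<Longrightarrow>
      L2_norm_on (extended_domain \<Omega> \<epsilon>) v \<le> Cpn * energy_norm (extended_domain \<Omega> \<epsilon>) (\<alpha> \<epsilon>) v"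
    using poincare by blast
  define B where "B = real DIM('a) ^ 5 / 48 * (Cpn\<^sup>2 + measure lborel \<Omega>)"
  \<comment> \<open>One constant for both estimates: it dominates \<open>B\<close> for the energy
    norm and \<open>\<bar>Cpn\<bar> * B\<close> for the L2 norm. The absolute value covers either
    sign of \<open>Cpn\<close>, and the added 1 keeps \<open>C\<close> positive.\<close>
  define C where "C = (1 + \<bar>Cpn\<bar>) * (B + 1)"
  have B0: "0 \<le> B" by (simp add: B_def)
  have C0: "0 < C" using B0 by (auto simp: C_def intro!: mult_pos_pos)
  have BC: "B \<le> C" "\<bar>Cpn\<bar> * B \<le> C"
    using B0 by (auto simp: C_def algebra_simps)
  show ?thesis
  proof (rule exI[of _ C], rule conjI[OF C0], intro ballI allI impI conjI)
    fix \<epsilon> :: real and s gl vn \<tau> ul u :: "'a \<Rightarrow> real"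
    assume \<epsilon>: "\<epsilon> \<in> {0<..\<epsilon>0}"
    define S where "S = extended_domain \<Omega> \<epsilon>"
    define e where "e = (\<lambda>x. u x - ul x)"
    assume dual: "in_constrained_dual (extended_domain \<Omega> \<epsilon>) (\<alpha> \<epsilon>) (\<Omega>D \<epsilon>) s"
      and "local_solution (extended_domain \<Omega> \<epsilon>) (\<Gamma>N \<epsilon>) (\<Gamma>D \<epsilon>) s gl \<tau> ul"
      and vn: "AE x in lborel. x \<in> \<Omega>D \<epsilon> \<longrightarrow> vn x = ul x"
      and weak: "nl_weak_solution \<Omega> \<epsilon> (\<alpha> \<epsilon>) (\<gamma> \<epsilon>) (\<Omega>N \<epsilon>) (\<Omega>D \<epsilon>) s ul vn u"
    then have ul: "Ck_upto_boundary 4 S ul" and s: "AE x in lborel. x \<in> S \<longrightarrow> - laplacian ul x = s x"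
      and u: "u \<in> energy_space S (\<alpha> \<epsilon>)"
      by (auto simp: local_solution_def nl_weak_solution_def S_def)
    have ulE: "ul \<in> energy_space S (\<alpha> \<epsilon>)"
      using C4_in_energy_space[OF \<epsilon>] ul by (simp add: S_def)
    have SB: "S \<in> sets borel" using open_extended_domain[of \<epsilon> \<Omega>] \<epsilon> by (simp add: S_def)
    have dec: "interaction_domain \<Omega> \<epsilon> = \<Omega>N \<epsilon> \<union> \<Omega>D \<epsilon>"
      using decomposition[OF \<epsilon>] by (simp add: admissible_decomposition_def)
    have uN: "AE x in lborel. x \<in> \<Omega>N \<epsilon> \<longrightarrow> u x = ul x"
      and uD: "AE x in lborel. x \<in> \<Omega>D \<epsilon> \<longrightarrow> u x = vn x"
      using weak by (auto simp: nl_weak_solution_def)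
    \<comment> \<open>On \<open>\<Omega>N \<epsilon>\<close> the constraint gives
      \<open>u = ul\<close> directly; on \<open>\<Omega>D \<epsilon>\<close> it passes through
      \<open>vn\<close>, where the agreement of \<open>vn\<close> with \<open>ul\<close>
      enters.\<close>
    have vanish: "AE x in lborel. x \<in> interaction_domain \<Omega> \<epsilon> \<longrightarrow> e x = 0"
      using uN uD vn by eventually_elim (auto simp: dec e_def)
    have eE: "e \<in> energy_space S (\<alpha> \<epsilon>)"
      unfolding e_def by (rule energy_space_diff[OF SB kernel[OF \<epsilon>] u ulE])
    have eD: "e \<in> energy_space_vanishing S (\<alpha> \<epsilon>) (\<Omega>D \<epsilon>)"
      using eE vanish by (auto simp: energy_space_vanishing_def dec elim: eventually_mono)
    have pe: "L2_norm_on S e \<le> Cpn * energy_norm S (\<alpha> \<epsilon>) e"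
      using Cpn[OF \<epsilon>] eD by (simp add: S_def)
    \<comment> \<open>Since \<open>e\<close> vanishes on \<open>\<Omega>D \<epsilon>\<close>, it is
      a test function for the dual space of \<open>s\<close>.\<close>
    have se: "set_integrable lborel S (\<lambda>x. s x * e x)"
      using dual eD by (simp add: in_constrained_dual_def S_def)
    have "energy_norm S (\<alpha> \<epsilon>) e \<le> B * \<epsilon>\<^sup>2 * D4_sup_norm S ul"
      unfolding B_def S_def e_def
    proof (rule nl_error_estimate[where s = s])
      show "nl_form (extended_domain \<Omega> \<epsilon>) (\<gamma> \<epsilon>) u z = (LINT x:\<Omega>|lborel. s x * z x)"
        if "z \<in> energy_space_vanishing (extended_domain \<Omega> \<epsilon>) (\<alpha> \<epsilon>) (interaction_domain \<Omega> \<epsilon>)" for z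
        using weak that by (simp add: nl_weak_solution_def)
    qed (use \<epsilon> domain kernel[OF \<epsilon>] cubic_exactness[OF \<epsilon>] green[OF \<epsilon>] ul ulE u vanish s se pe
        in \<open>simp_all add: S_def e_def\<close>)
    then have est: "energy_norm S (\<alpha> \<epsilon>) e \<le> B * (\<epsilon>\<^sup>2 * D4_sup_norm S ul)"
      by (simp only: mult.assoc)
    have D0: "0 \<le> \<epsilon>\<^sup>2 * D4_sup_norm S ul"
      using D4_sup_norm_nonneg[OF ul] bounded_extended_domain[of \<epsilon> \<Omega>] \<epsilon> domain by (simp add: S_def)
    have E0: "0 \<le> energy_norm S (\<alpha> \<epsilon>) e" by (simp add: energy_norm_def)
    show "energy_norm (extended_domain \<Omega> \<epsilon>) (\<alpha> \<epsilon>) (\<lambda>x. u x - ul x)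
        \<le> C * \<epsilon>\<^sup>2 * D4_sup_norm (extended_domain \<Omega> \<epsilon>) ul"
      using order_trans[OF est mult_right_mono[OF BC(1) D0]] by (simp add: S_def e_def mult.assoc)
    \<comment> \<open>The Poincare inequality once more, now applied to the finished energy
      bound.\<close>
    have "L2_norm_on S e \<le> \<bar>Cpn\<bar> * (B * (\<epsilon>\<^sup>2 * D4_sup_norm S ul))"
      using pe mult_mono[OF abs_ge_self[of Cpn] est _ E0] by simp
    also have "\<dots> \<le> C * (\<epsilon>\<^sup>2 * D4_sup_norm S ul)"
      using mult_right_mono[OF BC(2) D0] by (simp only: mult.assoc)
    finally show "L2_norm_on (extended_domain \<Omega> \<epsilon>) (\<lambda>x. u x - ul x)
        \<le> C * \<epsilon>\<^sup>2 * D4_sup_norm (extended_domain \<Omega> \<epsilon>) ul"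
      by (simp add: S_def e_def mult.assoc)
  qed
qed

end
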